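(* Let $\mathcal A$ be an abelian length category. The relation $$\mu(X)\leq\mu(Y)\quad:\Longleftrightarrow\quad\ell^*(X)\leq\ell^*(Y)\quad\text{for}\quad X,Y\in\mathcal A$$ induces a measure for the set of isomorphism classes of objects of $\mathcal A$, partially ordered by $\subseteq$.
   Context: An abelian length category is an abelian category in which every object has finite length and whose isomorphism classes of objects form a set. $\ell(X)$ is the composition length of $X$, and $\mathrm{ind}\,\mathcal A$ the set of isomorphism classes of indecomposable objects. Isomorphism classes of objects are partially ordered by: $X\subseteq Y$ if and only if there exists a monomorphism $X\to Y$; $X\subset Y$ means $X\subseteq Y$ and $X\not\cong Y$. $\mathbb N=\{1,2,\ldots\}$; $\mathrm{Ch}(\mathbb N)$ is the set of finite subsets of $\mathbb N$, totally ordered by the lexicographic order: $A\leq B$ if and only if $\min(B\setminus A)\leq\min(A\setminus B)$, with the convention that $\min\emptyset$ is larger than every $n\in\mathbb N$. For $X\in\mathrm{ind}\,\mathcal A$, $\ell^*(X)\in\mathrm{Ch}(\mathbb N)$ is the lexicographic maximum of the sets $\{\ell(X_1),\ldots,\ell(X_n)\}$ over all finite chains $X_1\subset\cdots\subset X_n=X$ in $\mathrm{ind}\,\mathcal A$. For an arbitrary object $X=\bigoplus_iX_i$ written as a finite direct sum of indecomposable objects (unique up to isomorphism by Krull-Remak-Schmidt), $\ell^*(X)=\max_i\ell^*(X_i)$, with $\ell^*(0)=\emptyset$. A measure $\mu$ for a partially ordered set $(S,\leq)$ is a relation on $S$, written $\mu(x)\leq\mu(y)$, such that for all $x,y,z\in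 S$: (M1) $\mu(x)\leq\mu(y)$ and $\mu(y)\leq\mu(z)$ imply $\mu(x)\leq\mu(z)$; (M2) $\mu(x)\leq\mu(y)$ or $\mu(y)\leq\mu(x)$; (M3) $x\leq y$ implies $\mu(x)\leq\mu(y)$. *)

theory Defs
  imports "HOL-Algebra.FiniteProduct" "HOL-Library.Extended_Nat"
begin

section \<open>Abelian categories\<close>

text \<open>
  Operations are total HOL functions and are only meaningful on arguments from the carriers
  \<open>obj\<close> and \<open>arr\<close>: \<open>comp_arr C g f\<close> is "g after f" and is constrained only when
  \<open>tgt C f = src C g\<close>, and \<open>plus_arr\<close> only for parallel arrows.
  As the objects form a HOL set, so do the isomorphism classes of objects.
\<close>

record ('o, 'm) precat =
  obj :: "'o set"
  arr :: "'m set"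
  src :: "'m \<Rightarrow> 'o"
  tgt :: "'m \<Rightarrow> 'o"
  ident :: "'o \<Rightarrow> 'm"
  comp_arr :: "'m \<Rightarrow> 'm \<Rightarrow> 'm"
  plus_arr :: "'m \<Rightarrow> 'm \<Rightarrow> 'm"
  zero_arr :: "'o \<Rightarrow> 'o \<Rightarrow> 'm"

definition Hom :: "('o, 'm, 'z) precat_scheme \<Rightarrow> 'o \<Rightarrow> 'o \<Rightarrow> 'm set" where
  "Hom C X Y = {f \<in> arr C. src C f = X \<and> tgt C f = Y}"

definition hom_group :: "('o, 'm, 'z) precat_scheme \<Rightarrow> 'o \<Rightarrow> 'o \<Rightarrow> 'm monoid" where
  "hom_group C X Y = \<lparr>carrier = Hom C X Y, mult = plus_arr C, one = zero_arr C X Y\<rparr>"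

locale category =
  fixes C :: "('o, 'm, 'z) precat_scheme"
  assumes src_obj: "f \<in> arr C \<Longrightarrow> src C f \<in> obj C"
    and tgt_obj: "f \<in> arr C \<Longrightarrow> tgt C f \<in> obj C"
    and ident_Hom: "X \<in> obj C \<Longrightarrow> ident C X \<in> Hom C X X"
    and comp_Hom: "f \<in> Hom C X Y \<Longrightarrow> g \<in> Hom C Y Z \<Longrightarrow> comp_arr C g f \<in> Hom C X Z"
    and ident_left: "f \<in> Hom C X Y \<Longrightarrow> comp_arr C (ident C Y) f = f"
    and ident_right: "f \<in> Hom C X Y \<Longrightarrow> comp_arr C f (ident C X) = f"
    and comp_assoc:
      "f \<in> Hom C W X \<Longrightarrow> g \<in> Hom C X Y \<Longrightarrow> h \<in> Hom C Y Z \<Longrightarrow>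
        comp_arr C h (comp_arr C g f) = comp_arr C (comp_arr C h g) f"

locale preadditive_category = category +
  assumes hom_comm_group: "X \<in> obj C \<Longrightarrow> Y \<in> obj C \<Longrightarrow> comm_group (hom_group C X Y)"
    and comp_plus_left:
      "f \<in> Hom C X Y \<Longrightarrow> g \<in> Hom C Y Z \<Longrightarrow> h \<in> Hom C Y Z \<Longrightarrow>
        comp_arr C (plus_arr C g h) f = plus_arr C (comp_arr C g f) (comp_arr C h f)"
    and comp_plus_right:
      "f \<in> Hom C X Y \<Longrightarrow> g \<in> Hom C X Y \<Longrightarrow> h \<in> Hom C Y Z \<Longrightarrow>
        comp_arr C h (plus_arr C f g) = plus_arr C (comp_arr C h f) (comp_arr C h g)"

definition is_mono :: "('o, 'm, 'z) precat_scheme \<Rightarrow> 'm \<Rightarrow> bool" where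
  "is_mono C f \<longleftrightarrow> f \<in> arr C \<and>
     (\<forall>W. \<forall>g \<in> Hom C W (src C f). \<forall>h \<in> Hom C W (src C f).
        comp_arr C f g = comp_arr C f h \<longrightarrow> g = h)"

definition is_epi :: "('o, 'm, 'z) precat_scheme \<Rightarrow> 'm \<Rightarrow> bool" where
  "is_epi C f \<longleftrightarrow> f \<in> arr C \<and>
     (\<forall>Z. \<forall>g \<in> Hom C (tgt C f) Z. \<forall>h \<in> Hom C (tgt C f) Z.
        comp_arr C g f = comp_arr C h f \<longrightarrow> g = h)"

definition is_iso :: "('o, 'm, 'z) precat_scheme \<Rightarrow> 'm \<Rightarrow> bool" where
  "is_iso C f \<longleftrightarrow> f \<in> arr C \<and>
     (\<exists>g \<in> Hom C (tgt C f) (src C f).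
        comp_arr C g f = ident C (src C f) \<and> comp_arr C f g = ident C (tgt C f))"

definition isomorphic :: "('o, 'm, 'z) precat_scheme \<Rightarrow> 'o \<Rightarrow> 'o \<Rightarrow> bool" where
  "isomorphic C X Y \<longleftrightarrow> (\<exists>f \<in> Hom C X Y. is_iso C f)"

definition is_zero_obj :: "('o, 'm, 'z) precat_scheme \<Rightarrow> 'o \<Rightarrow> bool" where
  "is_zero_obj C Z \<longleftrightarrow> Z \<in> obj C \<and>
     (\<forall>X \<in> obj C. (\<exists>!f. f \<in> Hom C X Z) \<and> (\<exists>!f. f \<in> Hom C Z X))"

definition is_kernel :: "('o, 'm, 'z) precat_scheme \<Rightarrow> 'm \<Rightarrow> 'm \<Rightarrow> bool" where
  "is_kernel C k f \<longleftrightarrow> k \<in> arr C \<and> f \<in> arr C \<and> tgt C k = src C f \<and>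
     comp_arr C f k = zero_arr C (src C k) (tgt C f) \<and>
     (\<forall>W. \<forall>h \<in> Hom C W (src C f). comp_arr C f h = zero_arr C W (tgt C f) \<longrightarrow>
        (\<exists>!u. u \<in> Hom C W (src C k) \<and> comp_arr C k u = h))"

definition is_cokernel :: "('o, 'm, 'z) precat_scheme \<Rightarrow> 'm \<Rightarrow> 'm \<Rightarrow> bool" where
  "is_cokernel C q f \<longleftrightarrow> q \<in> arr C \<and> f \<in> arr C \<and> src C q = tgt C f \<and>
     comp_arr C q f = zero_arr C (src C f) (tgt C q) \<and>
     (\<forall>Z. \<forall>h \<in> Hom C (tgt C f) Z. comp_arr C h f = zero_arr C (src C f) Z \<longrightarrow>
        (\<exists>!u. u \<in> Hom C (tgt C q) Z \<and> comp_arr C u q = h))"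

text \<open>
  \<open>X\<close> is the direct sum (biproduct) of the list \<open>Xs\<close> with inclusions \<open>inc i\<close> and
  projections \<open>pr i\<close>. The \<open>finprod\<close> is the sum of the \<open>inc i \<circ> pr i\<close> in the
  additive group \<open>Hom C X X\<close>; for \<open>Xs = []\<close> the condition says that the identity of
  \<open>X\<close> is zero.
\<close>

definition is_direct_sum ::
    "('o, 'm, 'z) precat_scheme \<Rightarrow> 'o \<Rightarrow> 'o list \<Rightarrow> (nat \<Rightarrow> 'm) \<Rightarrow> (nat \<Rightarrow> 'm) \<Rightarrow> bool" where
  "is_direct_sum C X Xs inc pr \<longleftrightarrow> X \<in> obj C \<and> set Xs \<subseteq> obj C \<and>
     (\<forall>i < length Xs. inc i \<in> Hom C (Xs ! i) X \<and> pr i \<in> Hom C X (Xs ! i)) \<and>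
     (\<forall>i < length Xs. \<forall>j < length Xs.
        comp_arr C (pr j) (inc i) = (if i = j then ident C (Xs ! i) else zero_arr C (Xs ! i) (Xs ! j))) \<and>
     finprod (hom_group C X X) (\<lambda>i. comp_arr C (inc i) (pr i)) {..<length Xs} = ident C X"

locale abelian_category = preadditive_category +
  assumes zero_obj_ex: "\<exists>Z. is_zero_obj C Z"
    and direct_sum_ex:
      "X \<in> obj C \<Longrightarrow> Y \<in> obj C \<Longrightarrow> \<exists>S inc pr. is_direct_sum C S [X, Y] inc pr"
    and kernel_ex: "f \<in> arr C \<Longrightarrow> \<exists>k. is_kernel C k f"
    and cokernel_ex: "f \<in> arr C \<Longrightarrow> \<exists>q. is_cokernel C q f"
    and mono_normal: "is_mono C f \<Longrightarrow> \<exists>g. is_kernel C f g"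
    and epi_normal: "is_epi C f \<Longrightarrow> \<exists>g. is_cokernel C f g"


section \<open>Length\<close>

definition is_simple :: "('o, 'm, 'z) precat_scheme \<Rightarrow> 'o \<Rightarrow> bool" where
  "is_simple C S \<longleftrightarrow> S \<in> obj C \<and> \<not> is_zero_obj C S \<and>
     (\<forall>f. is_mono C f \<and> tgt C f = S \<longrightarrow> is_zero_obj C (src C f) \<or> is_iso C f)"

definition is_composition_series ::
    "('o, 'm, 'z) precat_scheme \<Rightarrow> 'o \<Rightarrow> nat \<Rightarrow> (nat \<Rightarrow> 'o) \<Rightarrow> (nat \<Rightarrow> 'm) \<Rightarrow> bool" where
  "is_composition_series C X n F f \<longleftrightarrow>
     is_zero_obj C (F 0) \<and> F n = X \<and>
     (\<forall>i < n. f i \<in> Hom C (F i) (F (Suc i)) \<and> is_mono C (f i) \<and>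
        (\<exists>q. is_cokernel C q (f i) \<and> is_simple C (tgt C q)))"

definition finite_length :: "('o, 'm, 'z) precat_scheme \<Rightarrow> 'o \<Rightarrow> bool" where
  "finite_length C X \<longleftrightarrow> (\<exists>n F f. is_composition_series C X n F f)"

text \<open>By Jordan-Hoelder all composition series of an object have the same length.\<close>

definition comp_length :: "('o, 'm, 'z) precat_scheme \<Rightarrow> 'o \<Rightarrow> nat" where
  "comp_length C X = (LEAST n. \<exists>F f. is_composition_series C X n F f)"

locale abelian_length_category = abelian_category +
  assumes finite_length: "X \<in> obj C \<Longrightarrow> finite_length C X"

definition indecomposable :: "('o, 'm, 'z) precat_scheme \<Rightarrow> 'o \<Rightarrow> bool" where
  "indecomposable C X \<longleftrightarrow> X \<in> obj C \<and> \<not> is_zero_obj C X \<and>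
     (\<forall>A B inc pr. is_direct_sum C X [A, B] inc pr \<longrightarrow> is_zero_obj C A \<or> is_zero_obj C B)"

definition sub :: "('o, 'm, 'z) precat_scheme \<Rightarrow> 'o \<Rightarrow> 'o \<Rightarrow> bool" where
  "sub C X Y \<longleftrightarrow> (\<exists>f \<in> Hom C X Y. is_mono C f)"

definition strict_sub :: "('o, 'm, 'z) precat_scheme \<Rightarrow> 'o \<Rightarrow> 'o \<Rightarrow> bool" where
  "strict_sub C X Y \<longleftrightarrow> sub C X Y \<and> \<not> isomorphic C X Y"


section \<open>The length function \<open>\<ell>\<^sup>*\<close>\<close>

text \<open>In \<^typ>\<open>enat\<close> the infimum of the empty set is \<open>\<infinity>\<close>, which is the convention for \<open>min \<emptyset>\<close>.\<close>

definition lex_le :: "nat set \<Rightarrow> nat set \<Rightarrow> bool" where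
  "lex_le A B \<longleftrightarrow> (INF n \<in> B - A. enat n) \<le> (INF n \<in> A - B. enat n)"

definition lex_max :: "nat set set \<Rightarrow> nat set" where
  "lex_max \<A> = (THE A. A \<in> \<A> \<and> (\<forall>B \<in> \<A>. lex_le B A))"

definition ind_chain :: "('o, 'm, 'z) precat_scheme \<Rightarrow> 'o \<Rightarrow> 'o list \<Rightarrow> bool" where
  "ind_chain C X Xs \<longleftrightarrow> Xs \<noteq> [] \<and> (\<forall>Y \<in> set Xs. indecomposable C Y) \<and>
     successively (strict_sub C) Xs \<and> last Xs = X"

definition ell_star_ind :: "('o, 'm, 'z) precat_scheme \<Rightarrow> 'o \<Rightarrow> nat set" where
  "ell_star_ind C X = lex_max {comp_length C ` set Xs |Xs. ind_chain C X Xs}"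

text \<open>
  The maximum does not depend on the chosen decomposition into indecomposables, which
  is unique up to isomorphism and order by Krull-Remak-Schmidt.
\<close>

definition ell_star :: "('o, 'm, 'z) precat_scheme \<Rightarrow> 'o \<Rightarrow> nat set" where
  "ell_star C X = (THE A. \<exists>Xs inc pr. is_direct_sum C X Xs inc pr \<and>
     (\<forall>Y \<in> set Xs. indecomposable C Y) \<and>
     A = (if Xs = [] then {} else lex_max (ell_star_ind C ` set Xs)))"


section \<open>Measures and isomorphism classes\<close>

definition poset_measure :: "'a set \<Rightarrow> 'a rel \<Rightarrow> 'a rel \<Rightarrow> bool" where
  "poset_measure S r \<mu> \<longleftrightarrow> partial_order_on S r \<and> \<mu> \<subseteq> S \<times> S \<and>
     (\<forall>x \<in> S. \<forall>y \<in> S. \<forall>z \<in> S. (x, y) \<in> \<mu> \<and> (y, z) \<in> \<mu> \<longrightarrow> (x, z) \<in> \<mu>) \<and>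
     (\<forall>x \<in> S. \<forall>y \<in> S. (x, y) \<in> \<mu> \<or> (y, x) \<in> \<mu>) \<and>
     (\<forall>x \<in> S. \<forall>y \<in> S. (x, y) \<in> r \<longrightarrow> (x, y) \<in> \<mu>)"

definition iso_rel :: "('o, 'm, 'z) precat_scheme \<Rightarrow> 'o rel" where
  "iso_rel C = {(X, Y). X \<in> obj C \<and> Y \<in> obj C \<and> isomorphic C X Y}"

definition iso_classes :: "('o, 'm, 'z) precat_scheme \<Rightarrow> 'o set set" where
  "iso_classes C = obj C // iso_rel C"

definition induced_rel ::
    "('o, 'm, 'z) precat_scheme \<Rightarrow> ('o \<Rightarrow> 'o \<Rightarrow> bool) \<Rightarrow> 'o set rel" where
  "induced_rel C P =
     {(a, b). a \<in> iso_classes C \<and> b \<in> iso_classes C \<and> (\<exists>X \<in> a. \<exists>Y \<in> b. P X Y)}"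

definition mu_le :: "('o, 'm, 'z) precat_scheme \<Rightarrow> 'o \<Rightarrow> 'o \<Rightarrow> bool" where
  "mu_le C X Y \<longleftrightarrow> lex_le (ell_star C X) (ell_star C Y)"

end

theory Submission
  imports Defs
begin

text \<open>
  The heart of the matter is (M3), and it reduces to the following version of Gabriel's main
  property: if \<open>X\<close> is indecomposable and a family of morphisms \<open>X \<rightarrow> Y\<^sub>i\<close> with
  indecomposable targets is jointly monic, then some member is an isomorphism or
  \<open>\<ell>\<^sup>*(X) < \<ell>\<^sup>*(Y\<^sub>i)\<close> for some \<open>i\<close>. If some member is
  a proper monomorphism, extend a chain for \<open>X\<close> by \<open>Y\<^sub>i\<close>. Otherwise replace
  every member by its components into the indecomposable summands of its image. These are proper
  epimorphisms, so all the new targets are shorter than \<open>X\<close>; induction on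
  \<open>\<ell>(X)\<close> applies to the proper indecomposable subobjects \<open>X'\<close> of
  \<open>X\<close>, and an isomorphism \<open>X' \<rightarrow> X \<rightarrow> Y\<^sub>i\<close> would split
  \<open>X'\<close> off \<open>X\<close>. Hence \<open>\<ell>\<^sup>*(X')\<close> lies strictly below some
  \<open>\<ell>\<^sup>*(Y\<^sub>i)\<close>, and adding \<open>\<ell>(X)\<close>, which exceeds all members of
  \<open>\<ell>\<^sup>*(Y\<^sub>i)\<close>, does not change this.

  Monotonicity of the maximum over decompositions, applied to the identity in both directions, also
  shows that the maximum does not depend on the decomposition, so Krull-Remak-Schmidt is not needed.
  Likewise, the length as the least length of a composition series strictly drops along proper
  monomorphisms and proper epimorphisms, so Jordan-Hoelder is not needed.
\<close>

section \<open>Monomorphisms, epimorphisms and image factorization\<close>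

context category
begin

abbreviation comp_infix (infixr "\<cdot>" 70) where "g \<cdot> f \<equiv> comp_arr C g f"

lemma HomD:
  assumes "f \<in> Hom C X Y"
  shows "f \<in> arr C" "src C f = X" "tgt C f = Y" "X \<in> obj C" "Y \<in> obj C"
  using assms src_obj tgt_obj by (auto simp: Hom_def)

lemma arr_Hom: "f \<in> arr C \<Longrightarrow> f \<in> Hom C (src C f) (tgt C f)"
  by (simp add: Hom_def)

lemma mono_iff:
  assumes "f \<in> Hom C X Y"
  shows "is_mono C f \<longleftrightarrow> (\<forall>W. \<forall>g\<in>Hom C W X. \<forall>h\<in>Hom C W X. f \<cdot> g = f \<cdot> h \<longrightarrow> g = h)"
  using HomD[OF assms] by (auto simp: is_mono_def)

lemma epi_iff:
  assumes "f \<in> Hom C X Y"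
  shows "is_epi C f \<longleftrightarrow> (\<forall>Z. \<forall>g\<in>Hom C Y Z. \<forall>h\<in>Hom C Y Z. g \<cdot> f = h \<cdot> f \<longrightarrow> g = h)"
  using HomD[OF assms] by (auto simp: is_epi_def)

lemma iso_iff:
  assumes "f \<in> Hom C X Y"
  shows "is_iso C f \<longleftrightarrow> (\<exists>g\<in>Hom C Y X. g \<cdot> f = ident C X \<and> f \<cdot> g = ident C Y)"
  using HomD[OF assms] by (auto simp: is_iso_def)

lemma mono_comp:
  assumes "f \<in> Hom C X Y" "g \<in> Hom C Y Z" "is_mono C f" "is_mono C g"
  shows "is_mono C (g \<cdot> f)"
  unfolding mono_iff[OF comp_Hom[OF assms(1,2)]]
proof (intro allI ballI impI)
  fix W h k assume hk: "h \<in> Hom C W X" "k \<in> Hom C W X" "(g \<cdot> f) \<cdot> h = (g \<cdot> f) \<cdot> k"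
  have "g \<cdot> (f \<cdot> h) = g \<cdot> (f \<cdot> k)"
    using comp_assoc[OF hk(1) assms(1,2)] comp_assoc[OF hk(2) assms(1,2)] hk(3) by simp
  then have "f \<cdot> h = f \<cdot> k"
    using assms(4) comp_Hom[OF hk(1) assms(1)] comp_Hom[OF hk(2) assms(1)]
    unfolding mono_iff[OF assms(2)] by blast
  then show "h = k"
    using assms(3) hk unfolding mono_iff[OF assms(1)] by blast
qed

lemma mono_cancel:
  assumes "f \<in> Hom C X Y" "g \<in> Hom C Y Z" "is_mono C (g \<cdot> f)"
  shows "is_mono C f"
  unfolding mono_iff[OF assms(1)]
proof (intro allI ballI impI)
  fix W h k assume hk: "h \<in> Hom C W X" "k \<in> Hom C W X" "f \<cdot> h = f \<cdot> k"
  have "(g \<cdot> f) \<cdot> h = (g \<cdot> f) \<cdot> k"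
    using comp_assoc[OF hk(1) assms(1,2)] comp_assoc[OF hk(2) assms(1,2)] hk(3) by simp
  then show "h = k"
    using assms(3) hk unfolding mono_iff[OF comp_Hom[OF assms(1,2)]] by blast
qed

lemma epi_comp:
  assumes "f \<in> Hom C X Y" "g \<in> Hom C Y Z" "is_epi C f" "is_epi C g"
  shows "is_epi C (g \<cdot> f)"
  unfolding epi_iff[OF comp_Hom[OF assms(1,2)]]
proof (intro allI ballI impI)
  fix W h k assume hk: "h \<in> Hom C Z W" "k \<in> Hom C Z W" "h \<cdot> (g \<cdot> f) = k \<cdot> (g \<cdot> f)"
  have "(h \<cdot> g) \<cdot> f = (k \<cdot> g) \<cdot> f"
    using comp_assoc[OF assms(1,2) hk(1)] comp_assoc[OF assms(1,2) hk(2)] hk(3) by simp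
  then have "h \<cdot> g = k \<cdot> g"
    using assms(3) comp_Hom[OF assms(2) hk(1)] comp_Hom[OF assms(2) hk(2)]
    unfolding epi_iff[OF assms(1)] by blast
  then show "h = k"
    using assms(4) hk unfolding epi_iff[OF assms(2)] by blast
qed

lemma retraction_mono:
  assumes "f \<in> Hom C X Y" "g \<in> Hom C Y X" "g \<cdot> f = ident C X"
  shows "is_mono C f"
  unfolding mono_iff[OF assms(1)]
proof (intro allI ballI impI)
  fix W h k assume hk: "h \<in> Hom C W X" "k \<in> Hom C W X" "f \<cdot> h = f \<cdot> k"
  show "h = k"
    using comp_assoc[OF hk(1) assms(1,2)] comp_assoc[OF hk(2) assms(1,2)] hk(3) assms(3)
      ident_left[OF hk(1)] ident_left[OF hk(2)] by metis
qed

lemma retraction_epi: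
  assumes "f \<in> Hom C X Y" "g \<in> Hom C Y X" "g \<cdot> f = ident C X"
  shows "is_epi C g"
  unfolding epi_iff[OF assms(2)]
proof (intro allI ballI impI)
  fix W h k assume hk: "h \<in> Hom C X W" "k \<in> Hom C X W" "h \<cdot> g = k \<cdot> g"
  show "h = k"
    using comp_assoc[OF assms(1,2) hk(1)] comp_assoc[OF assms(1,2) hk(2)] hk(3) assms(3)
      ident_right[OF hk(1)] ident_right[OF hk(2)] by metis
qed

lemma iso_mono: "is_iso C f \<Longrightarrow> is_mono C f"
  and iso_epi: "is_iso C f \<Longrightarrow> is_epi C f"
  using retraction_mono retraction_epi arr_Hom unfolding is_iso_def by metis+

lemma ident_iso: "X \<in> obj C \<Longrightarrow> is_iso C (ident C X)"
  using ident_Hom ident_left iso_iff by metis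

lemma iso_comp:
  assumes "f \<in> Hom C X Y" "g \<in> Hom C Y Z" "is_iso C f" "is_iso C g"
  shows "is_iso C (g \<cdot> f)"
proof -
  obtain f' g' where i: "f' \<in> Hom C Y X" "f' \<cdot> f = ident C X" "f \<cdot> f' = ident C Y"
    "g' \<in> Hom C Z Y" "g' \<cdot> g = ident C Y" "g \<cdot> g' = ident C Z"
    using assms iso_iff by metis
  have "(f' \<cdot> g') \<cdot> (g \<cdot> f) = f' \<cdot> ((g' \<cdot> g) \<cdot> f)" "(g \<cdot> f) \<cdot> (f' \<cdot> g') = g \<cdot> ((f \<cdot> f') \<cdot> g')"
    using comp_assoc[OF comp_Hom[OF assms(1,2)] i(4,1)] comp_assoc[OF assms(1,2) i(4)]
      comp_assoc[OF comp_Hom[OF i(4,1)] assms(1,2)] comp_assoc[OF i(4,1) assms(1)] by simp_all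
  then have "(f' \<cdot> g') \<cdot> (g \<cdot> f) = ident C X" "(g \<cdot> f) \<cdot> (f' \<cdot> g') = ident C Z"
    using i ident_left[OF assms(1)] ident_left[OF i(4)] by simp_all
  then show ?thesis
    using iso_iff[OF comp_Hom[OF assms(1,2)]] comp_Hom[OF i(4,1)] by blast
qed

lemma isoE:
  assumes "f \<in> Hom C X Y" "is_iso C f"
  obtains g where "g \<in> Hom C Y X" "is_iso C g" "g \<cdot> f = ident C X" "f \<cdot> g = ident C Y"
  using assms iso_iff by metis

lemma isomorphic_refl: "X \<in> obj C \<Longrightarrow> isomorphic C X X"
  using ident_iso ident_Hom unfolding isomorphic_def by blast

lemma isomorphic_sym: "isomorphic C X Y \<Longrightarrow> isomorphic C Y X"
  unfolding isomorphic_def using isoE by metis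

lemma isomorphic_trans: "isomorphic C X Y \<Longrightarrow> isomorphic C Y Z \<Longrightarrow> isomorphic C X Z"
  unfolding isomorphic_def using iso_comp comp_Hom by metis

lemma isomorphic_sub: "isomorphic C X Y \<Longrightarrow> sub C X Y"
  unfolding isomorphic_def sub_def using iso_mono by blast

lemma sub_trans: "sub C X Y \<Longrightarrow> sub C Y Z \<Longrightarrow> sub C X Z"
  unfolding sub_def using mono_comp comp_Hom by metis

lemma equiv_iso_rel: "equiv (obj C) (iso_rel C)"
proof (intro equivI refl_onI symI transI)
  show "iso_rel C \<subseteq> obj C \<times> obj C" by (auto simp: iso_rel_def)
qed (use isomorphic_refl isomorphic_sym isomorphic_trans in \<open>unfold iso_rel_def, blast+\<close>)

end

section \<open>Zero arrows, zero objects, and the universal properties of kernels and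
  cokernels\<close>

context preadditive_category
begin

abbreviation plus_infix (infixl "\<oplus>" 65) where "g \<oplus> f \<equiv> plus_arr C g f"

lemma zero_Hom: "X \<in> obj C \<Longrightarrow> Y \<in> obj C \<Longrightarrow> zero_arr C X Y \<in> Hom C X Y"
  using hom_comm_group[of X Y] comm_group.axioms(2) group.is_monoid monoid.one_closed
  by (fastforce simp: hom_group_def)

lemma plus_zero:
  assumes "f \<in> Hom C X Y"
  shows "f \<oplus> zero_arr C X Y = f" "zero_arr C X Y \<oplus> f = f"
proof -
  interpret comm_group "hom_group C X Y" using hom_comm_group[OF HomD(4,5)[OF assms(1)]] .
  show "f \<oplus> zero_arr C X Y = f" "zero_arr C X Y \<oplus> f = f"
    using l_one[of f] r_one[of f] assms by (auto simp: hom_group_def)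
qed

lemma plus_cancel:
  assumes "f \<in> Hom C X Y" "g \<in> Hom C X Y" "h \<in> Hom C X Y" "f \<oplus> g = f \<oplus> h"
  shows "g = h"
proof -
  interpret comm_group "hom_group C X Y" using hom_comm_group[OF HomD(4,5)[OF assms(1)]] .
  show ?thesis using Units_l_cancel[of f g h] Units_eq assms by (auto simp: hom_group_def)
qed

text \<open>Cancelling \<open>f\<close> is how arrows are shown to vanish below; composites with a
  zero arrow, for instance, are equal to their own double.\<close>

lemma plus_cancel_zero:
  assumes "f \<in> Hom C X Y" "g \<in> Hom C X Y" "f \<oplus> g = f"
  shows "g = zero_arr C X Y"
  using plus_cancel[OF assms(1,2) zero_Hom[OF HomD(4,5)[OF assms(1)]]] plus_zero(1)[OF assms(1)] assms(3)
  by simp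

text \<open>The record has no negation; \<open>d\<close> plays the role of
  \<open>g - f\<close>.\<close>

lemma diff_ex:
  assumes "f \<in> Hom C X Y" "g \<in> Hom C X Y"
  obtains d where "d \<in> Hom C X Y" "f \<oplus> d = g"
proof -
  interpret comm_group "hom_group C X Y" using hom_comm_group[OF HomD(4,5)[OF assms(1)]] .
  have fg: "f \<in> carrier (hom_group C X Y)" "g \<in> carrier (hom_group C X Y)"
    using assms by (auto simp: hom_group_def)
  define d where "d = inv\<^bsub>hom_group C X Y\<^esub> f \<otimes>\<^bsub>hom_group C X Y\<^esub> g"
  have "d \<in> carrier (hom_group C X Y)" "f \<otimes>\<^bsub>hom_group C X Y\<^esub> d = g"
    using fg by (simp_all add: d_def m_assoc[symmetric])
  then show thesis using that by (auto simp: hom_group_def)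
qed

lemma comp_zero_right:
  assumes "f \<in> Hom C X Y" "W \<in> obj C"
  shows "f \<cdot> zero_arr C W X = zero_arr C W Y"
proof (rule plus_cancel_zero)
  have z: "zero_arr C W X \<in> Hom C W X" using zero_Hom[OF assms(2) HomD(4)[OF assms(1)]] .
  then show "f \<cdot> zero_arr C W X \<in> Hom C W Y" "f \<cdot> zero_arr C W X \<in> Hom C W Y"
    using comp_Hom[OF _ assms(1)] by blast+
  show "f \<cdot> zero_arr C W X \<oplus> f \<cdot> zero_arr C W X = f \<cdot> zero_arr C W X"
    using comp_plus_right[OF z z assms(1)] plus_zero(1)[OF z] by simp
qed

lemma comp_zero_left:
  assumes "f \<in> Hom C X Y" "Z \<in> obj C"
  shows "zero_arr C Y Z \<cdot> f = zero_arr C X Z"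
proof (rule plus_cancel_zero)
  have z: "zero_arr C Y Z \<in> Hom C Y Z" using zero_Hom[OF HomD(5)[OF assms(1)] assms(2)] .
  then show "zero_arr C Y Z \<cdot> f \<in> Hom C X Z" "zero_arr C Y Z \<cdot> f \<in> Hom C X Z"
    using comp_Hom[OF assms(1)] by blast+
  show "zero_arr C Y Z \<cdot> f \<oplus> zero_arr C Y Z \<cdot> f = zero_arr C Y Z \<cdot> f"
    using comp_plus_left[OF assms(1) z z] plus_zero(1)[OF z] by simp
qed

text \<open>Two arrows with the same composite differ by an arrow that \<open>f\<close> kills, so
  testing against zero suffices.\<close>

lemma mono_zeroI:
  assumes f: "f \<in> Hom C X Y"
    and z: "\<And>W g. g \<in> Hom C W X \<Longrightarrow> f \<cdot> g = zero_arr C W Y \<Longrightarrow> g = zero_arr C W X"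
  shows "is_mono C f"
  unfolding mono_iff[OF f]
proof (intro allI ballI impI)
  fix W g h assume g: "g \<in> Hom C W X" and h: "h \<in> Hom C W X" and eq: "f \<cdot> g = f \<cdot> h"
  obtain d where d: "d \<in> Hom C W X" "h \<oplus> d = g" using diff_ex[OF h g] .
  have "f \<cdot> h \<oplus> f \<cdot> d = f \<cdot> h" using comp_plus_right[OF h d(1) f] d eq by simp
  then have "f \<cdot> d = zero_arr C W Y" using plus_cancel_zero comp_Hom[OF h f] comp_Hom[OF d(1) f] by blast
  then show "g = h" using z[OF d(1)] d(2) plus_zero(1)[OF h] by simp
qed

lemma mono_zeroD:
  assumes "f \<in> Hom C X Y" "is_mono C f" "g \<in> Hom C W X" "f \<cdot> g = zero_arr C W Y"
  shows "g = zero_arr C W X"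
proof -
  have "f \<cdot> g = f \<cdot> zero_arr C W X" "zero_arr C W X \<in> Hom C W X"
    using assms(4) comp_zero_right[OF assms(1) HomD(4)[OF assms(3)]]
      zero_Hom[OF HomD(4)[OF assms(3)] HomD(4)[OF assms(1)]] by simp_all
  then show ?thesis using assms(2,3) unfolding mono_iff[OF assms(1)] by blast
qed

lemma epi_zeroI:
  assumes f: "f \<in> Hom C X Y"
    and z: "\<And>W g. g \<in> Hom C Y W \<Longrightarrow> g \<cdot> f = zero_arr C X W \<Longrightarrow> g = zero_arr C Y W"
  shows "is_epi C f"
  unfolding epi_iff[OF f]
proof (intro allI ballI impI)
  fix W g h assume g: "g \<in> Hom C Y W" and h: "h \<in> Hom C Y W" and eq: "g \<cdot> f = h \<cdot> f"
  obtain d where d: "d \<in> Hom C Y W" "h \<oplus> d = g" using diff_ex[OF h g] .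
  have "h \<cdot> f \<oplus> d \<cdot> f = h \<cdot> f" using comp_plus_left[OF f h d(1)] d eq by simp
  then have "d \<cdot> f = zero_arr C X W" using plus_cancel_zero comp_Hom[OF f h] comp_Hom[OF f d(1)] by blast
  then show "g = h" using z[OF d(1)] d(2) plus_zero(1)[OF h] by simp
qed

lemma epi_zeroD:
  assumes "f \<in> Hom C X Y" "is_epi C f" "g \<in> Hom C Y W" "g \<cdot> f = zero_arr C X W"
  shows "g = zero_arr C Y W"
proof -
  have "g \<cdot> f = zero_arr C Y W \<cdot> f" "zero_arr C Y W \<in> Hom C Y W"
    using assms(4) comp_zero_left[OF assms(1) HomD(5)[OF assms(3)]]
      zero_Hom[OF HomD(5)[OF assms(1)] HomD(5)[OF assms(3)]] by simp_all
  then show ?thesis using assms(2,3) unfolding epi_iff[OF assms(1)] by blast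
qed

text \<open>Every arrow into or out of \<open>X\<close> equals its composite with the identity of
  \<open>X\<close>, so a zero identity leaves only zero arrows.\<close>

lemma zero_obj_iff:
  assumes "X \<in> obj C"
  shows "is_zero_obj C X \<longleftrightarrow> ident C X = zero_arr C X X"
proof
  assume "is_zero_obj C X"
  then show "ident C X = zero_arr C X X"
    using ident_Hom zero_Hom assms unfolding is_zero_obj_def by blast
next
  assume id: "ident C X = zero_arr C X X"
  have "f = zero_arr C Y X" if "f \<in> Hom C Y X" for f Y
    using ident_left[OF that] comp_zero_left[OF that assms] id by simp
  moreover have "f = zero_arr C X Y" if "f \<in> Hom C X Y" for f Y
    using ident_right[OF that] comp_zero_right[OF that assms] id by simp
  ultimately show "is_zero_obj C X"
    unfolding is_zero_obj_def using assms zero_Hom by metis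
qed

lemma zero_obj_Hom:
  assumes "is_zero_obj C Z"
  shows "f \<in> Hom C X Z \<Longrightarrow> f = zero_arr C X Z" "f \<in> Hom C Z X \<Longrightarrow> f = zero_arr C Z X"
proof -
  assume f: "f \<in> Hom C X Z"
  then have "\<exists>!f. f \<in> Hom C X Z" using assms HomD(4)[OF f] unfolding is_zero_obj_def by blast
  then show "f = zero_arr C X Z" using f zero_Hom[OF HomD(4,5)[OF f]] by blast
next
  assume f: "f \<in> Hom C Z X"
  then have "\<exists>!f. f \<in> Hom C Z X" using assms HomD(5)[OF f] unfolding is_zero_obj_def by blast
  then show "f = zero_arr C Z X" using f zero_Hom[OF HomD(4,5)[OF f]] by blast
qed

lemma mono_into_zero_obj:
  assumes "f \<in> Hom C X Z" "is_mono C f" "is_zero_obj C Z"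
  shows "is_zero_obj C X"
proof -
  have X: "X \<in> obj C" using HomD[OF assms(1)] by blast
  have "f \<cdot> ident C X = zero_arr C X Z" using zero_obj_Hom(1)[OF assms(3,1)] ident_right[OF assms(1)] by simp
  then show ?thesis using mono_zeroD[OF assms(1,2) ident_Hom[OF X]] zero_obj_iff[OF X] by simp
qed

lemma epi_from_zero_obj:
  assumes "f \<in> Hom C Z X" "is_epi C f" "is_zero_obj C Z"
  shows "is_zero_obj C X"
proof -
  have X: "X \<in> obj C" using HomD[OF assms(1)] by blast
  have "ident C X \<cdot> f = zero_arr C Z X" using zero_obj_Hom(2)[OF assms(3,1)] ident_left[OF assms(1)] by simp
  then show ?thesis using epi_zeroD[OF assms(1,2) ident_Hom[OF X]] zero_obj_iff[OF X] by simp
qed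

lemma zero_obj_iso:
  assumes "f \<in> Hom C X Y" "is_zero_obj C X" "is_zero_obj C Y"
  shows "is_iso C f"
proof -
  have o: "X \<in> obj C" "Y \<in> obj C" using HomD[OF assms(1)] by blast+
  have z: "zero_arr C Y X \<in> Hom C Y X" using zero_Hom o by blast
  have "zero_arr C Y X \<cdot> f = ident C X" "f \<cdot> zero_arr C Y X = ident C Y"
    using zero_obj_Hom(1)[OF assms(2)] zero_obj_Hom(1)[OF assms(3)]
      comp_Hom[OF assms(1) z] comp_Hom[OF z assms(1)] ident_Hom[OF o(1)] ident_Hom[OF o(2)] by metis+
  then show ?thesis using iso_iff[OF assms(1)] z by blast
qed

lemma kernelD:
  assumes "is_kernel C k f" "f \<in> Hom C X Y"
  shows "k \<in> Hom C (src C k) X" "f \<cdot> k = zero_arr C (src C k) Y"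
  using assms HomD[OF assms(2)] by (auto simp: is_kernel_def Hom_def)

lemma kernelE:
  assumes "is_kernel C k f" "f \<in> Hom C X Y" "h \<in> Hom C W X" "f \<cdot> h = zero_arr C W Y"
  obtains u where "u \<in> Hom C W (src C k)" "k \<cdot> u = h"
  using assms HomD[OF assms(2)] unfolding is_kernel_def by blast

lemma kernel_mono:
  assumes "is_kernel C k f"
  shows "is_mono C k"
proof -
  define X Y K where "X = src C f" "Y = tgt C f" "K = src C k"
  have f: "f \<in> Hom C X Y" using assms arr_Hom unfolding is_kernel_def X_Y_K_def by blast
  have k: "k \<in> Hom C K X" "f \<cdot> k = zero_arr C K Y" using kernelD[OF assms f] unfolding X_Y_K_def by auto
  have "g = h" if gh: "g \<in> Hom C W K" "h \<in> Hom C W K" "k \<cdot> g = k \<cdot> h" for W g h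
  proof -
    have "f \<cdot> (k \<cdot> h) = zero_arr C W Y"
      using comp_assoc[OF gh(2) k(1) f] k(2) comp_zero_left[OF gh(2) HomD(5)[OF f]] by simp
    moreover have "k \<cdot> h \<in> Hom C W X" using comp_Hom[OF gh(2) k(1)] .
    ultimately have "\<exists>!u. u \<in> Hom C W K \<and> k \<cdot> u = k \<cdot> h"
      using assms unfolding is_kernel_def X_Y_K_def by blast
    then show "g = h" using gh by blast
  qed
  then show ?thesis unfolding mono_iff[OF k(1)] by blast
qed

lemma cokernelD:
  assumes "is_cokernel C q f" "f \<in> Hom C X Y"
  shows "q \<in> Hom C Y (tgt C q)" "q \<cdot> f = zero_arr C X (tgt C q)"
  using assms HomD[OF assms(2)] by (auto simp: is_cokernel_def Hom_def)

lemma cokernelE: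
  assumes "is_cokernel C q f" "f \<in> Hom C X Y" "h \<in> Hom C Y Z" "h \<cdot> f = zero_arr C X Z"
  obtains u where "u \<in> Hom C (tgt C q) Z" "u \<cdot> q = h"
  using assms HomD[OF assms(2)] unfolding is_cokernel_def by blast

lemma cokernel_epi:
  assumes "is_cokernel C q f"
  shows "is_epi C q"
proof -
  define X Y K where "X = src C f" "Y = tgt C f" "K = tgt C q"
  have f: "f \<in> Hom C X Y" using assms arr_Hom unfolding is_cokernel_def X_Y_K_def by blast
  have q: "q \<in> Hom C Y K" "q \<cdot> f = zero_arr C X K" using cokernelD[OF assms f] unfolding X_Y_K_def by auto
  have "g = h" if gh: "g \<in> Hom C K W" "h \<in> Hom C K W" "g \<cdot> q = h \<cdot> q" for W g h
  proof -
    have "(h \<cdot> q) \<cdot> f = zero_arr C X W"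
      using comp_assoc[OF f q(1) gh(2)] q(2) comp_zero_right[OF gh(2) HomD(4)[OF f]] by simp
    moreover have "h \<cdot> q \<in> Hom C Y W" using comp_Hom[OF q(1) gh(2)] .
    ultimately have "\<exists>!u. u \<in> Hom C K W \<and> u \<cdot> q = h \<cdot> q"
      using assms unfolding is_cokernel_def X_Y_K_def by blast
    then show "g = h" using gh by blast
  qed
  then show ?thesis unfolding epi_iff[OF q(1)] by blast
qed

text \<open>Monicity of \<open>k\<close> yields uniqueness of factorizations, so only their
  existence is asked for.\<close>

lemma is_kernelI:
  assumes "k \<in> Hom C K X" "f \<in> Hom C X Y" "is_mono C k" "f \<cdot> k = zero_arr C K Y"
    and "\<And>W h. h \<in> Hom C W X \<Longrightarrow> f \<cdot> h = zero_arr C W Y \<Longrightarrow> \<exists>u\<in>Hom C W K. k \<cdot> u = h"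
  shows "is_kernel C k f"
proof -
  have "u = v" if "u \<in> Hom C W K" "v \<in> Hom C W K" "k \<cdot> u = k \<cdot> v" for W u v
    using that assms(3) unfolding mono_iff[OF assms(1)] by blast
  then show ?thesis
    using HomD[OF assms(1)] HomD[OF assms(2)] assms(4,5) unfolding is_kernel_def by simp metis
qed

lemma is_cokernelI:
  assumes "f \<in> Hom C X Y" "q \<in> Hom C Y K" "is_epi C q" "q \<cdot> f = zero_arr C X K"
    and "\<And>Z h. h \<in> Hom C Y Z \<Longrightarrow> h \<cdot> f = zero_arr C X Z \<Longrightarrow> \<exists>u\<in>Hom C K Z. u \<cdot> q = h"
  shows "is_cokernel C q f"
proof -
  have "u = v" if "u \<in> Hom C K Z" "v \<in> Hom C K Z" "u \<cdot> q = v \<cdot> q" for Z u v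
    using that assms(3) unfolding epi_iff[OF assms(2)] by blast
  then show ?thesis
    using HomD[OF assms(1)] HomD[OF assms(2)] assms(4,5) unfolding is_cokernel_def by simp metis
qed

end

section \<open>Consequences of normality: balancedness and images\<close>

context abelian_category
begin

text \<open>By normality \<open>k\<close> is a kernel of some \<open>g\<close>, and \<open>g\<close>
  factors through the cokernel \<open>q\<close>. Whatever \<open>q\<close> kills is therefore killed
  by \<open>g\<close> and lifts along \<open>k\<close>.\<close>

lemma mono_kernel_of_cokernel:
  assumes "is_mono C k" "is_cokernel C q k"
  shows "is_kernel C k q"
proof -
  obtain K X where k: "k \<in> Hom C K X" using assms(1) arr_Hom unfolding is_mono_def by blast
  note q = cokernelD[OF assms(2) k]
  obtain g where g: "is_kernel C k g" using mono_normal assms by blast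
  have gH: "g \<in> Hom C X (tgt C g)" using g HomD[OF k] unfolding is_kernel_def Hom_def by auto
  have sk: "src C k = K" using HomD[OF k] by simp
  obtain v where v: "v \<in> Hom C (tgt C q) (tgt C g)" "v \<cdot> q = g"
    using cokernelE[OF assms(2) k gH] kernelD(2)[OF g gH] sk by metis
  show ?thesis
  proof (rule is_kernelI[OF k q(1) assms(1) q(2)])
    fix W h assume h: "h \<in> Hom C W X" "q \<cdot> h = zero_arr C W (tgt C q)"
    have "g \<cdot> h = zero_arr C W (tgt C g)"
      using comp_assoc[OF h(1) q(1) v(1)] v h comp_zero_right[OF v(1) HomD(4)[OF h(1)]] by simp
    then show "\<exists>u\<in>Hom C W K. k \<cdot> u = h" using kernelE[OF g gH h(1)] sk by metis
  qed
qed

text \<open>Dually, \<open>q\<close> is a cokernel of some \<open>g\<close> that factors through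
  \<open>k\<close>, so whatever kills \<open>k\<close> kills \<open>g\<close> and descends along
  \<open>q\<close>.\<close>

lemma epi_cokernel_of_kernel:
  assumes "is_epi C q" "is_kernel C k q"
  shows "is_cokernel C q k"
proof -
  obtain K X where q: "q \<in> Hom C X K" using assms(1) arr_Hom unfolding is_epi_def by blast
  note k = kernelD[OF assms(2) q]
  obtain g where g: "is_cokernel C q g" using epi_normal assms by blast
  have gH: "g \<in> Hom C (src C g) X" using g HomD[OF q] unfolding is_cokernel_def Hom_def by auto
  have tq: "tgt C q = K" using HomD[OF q] by simp
  obtain v where v: "v \<in> Hom C (src C g) (src C k)" "k \<cdot> v = g"
    using kernelE[OF assms(2) q gH] cokernelD(2)[OF g gH] tq by metis
  show ?thesis
  proof (rule is_cokernelI[OF k(1) q assms(1) k(2)])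
    fix W h assume h: "h \<in> Hom C X W" "h \<cdot> k = zero_arr C (src C k) W"
    have "h \<cdot> g = zero_arr C (src C g) W"
      using comp_assoc[OF v(1) k(1) h(1)] v h comp_zero_left[OF v(1) HomD(5)[OF h(1)]] by simp
    then show "\<exists>u\<in>Hom C K W. u \<cdot> q = h" using cokernelE[OF g gH h(1)] tq by metis
  qed
qed

text \<open>As a monomorphism \<open>f\<close> is a kernel of some \<open>g\<close>; as
  \<open>f\<close> is epi, \<open>g\<close> is zero. The identity of \<open>Y\<close> then lifts
  along \<open>f\<close>, which gives a right inverse, and monicity makes it two-sided.\<close>

lemma mono_epi_iso:
  assumes f: "f \<in> Hom C X Y" and m: "is_mono C f" and e: "is_epi C f"
  shows "is_iso C f"
proof -
  have o: "X \<in> obj C" "Y \<in> obj C" using HomD[OF f] by blast+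
  obtain g where g: "is_kernel C f g" using mono_normal m by blast
  have gH: "g \<in> Hom C Y (tgt C g)" using g HomD[OF f] unfolding is_kernel_def Hom_def by auto
  have sf: "src C f = X" using HomD[OF f] by simp
  have "g = zero_arr C Y (tgt C g)"
    using epi_zeroD[OF f e gH] kernelD(2)[OF g gH] sf by simp
  then have "g \<cdot> ident C Y = zero_arr C Y (tgt C g)"
    using ident_right[OF gH] by simp
  then obtain u where u: "u \<in> Hom C Y X" "f \<cdot> u = ident C Y"
    using kernelE[OF g gH ident_Hom[OF o(2)]] sf by metis
  have "f \<cdot> (u \<cdot> f) = f \<cdot> ident C X"
    using comp_assoc[OF f u(1) f] u ident_left[OF f] ident_right[OF f] by simp
  then have "u \<cdot> f = ident C X"
    using m comp_Hom[OF f u(1)] ident_Hom[OF o(1)] unfolding mono_iff[OF f] by blast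
  then show ?thesis using u iso_iff[OF f] by blast
qed

text \<open>The image is the kernel \<open>m\<close> of the cokernel \<open>q\<close> of
  \<open>f\<close>. The induced \<open>e\<close> is epi because no smaller subobject of the image
  can contain \<open>f\<close>.\<close>

lemma epi_mono_factorization:
  assumes f: "f \<in> Hom C X Y"
  obtains I e m where "e \<in> Hom C X I" "m \<in> Hom C I Y" "is_epi C e" "is_mono C m" "m \<cdot> e = f"
proof -
  obtain q where q: "is_cokernel C q f" using cokernel_ex HomD[OF f] by blast
  note qH = cokernelD[OF q f]
  obtain m where m: "is_kernel C m q" using kernel_ex HomD[OF qH(1)] by blast
  define I where "I = src C m"
  have mH: "m \<in> Hom C I Y" "q \<cdot> m = zero_arr C I (tgt C q)"
    using kernelD[OF m qH(1)] unfolding I_def by auto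
  have mm: "is_mono C m" using kernel_mono m by blast
  obtain e where e: "e \<in> Hom C X I" "m \<cdot> e = f"
    using kernelE[OF m qH(1) f qH(2)] unfolding I_def by metis
  have "is_epi C e"
  proof (rule epi_zeroI[OF e(1)])
    fix Z g assume g: "g \<in> Hom C I Z" "g \<cdot> e = zero_arr C X Z"
    obtain k where k: "is_kernel C k g" using kernel_ex HomD[OF g(1)] by blast
    define K where "K = src C k"
    have kH: "k \<in> Hom C K I" "g \<cdot> k = zero_arr C K Z"
      using kernelD[OF k g(1)] unfolding K_def by auto
    obtain e' where e': "e' \<in> Hom C X K" "k \<cdot> e' = e"
      using kernelE[OF k g(1) e(1) g(2)] unfolding K_def by metis
    have mkH: "m \<cdot> k \<in> Hom C K Y" using comp_Hom[OF kH(1) mH(1)] .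
    \<comment> \<open>Normality presents the subobject \<open>m \<cdot> k\<close> as a kernel of
      \<open>h\<close>. As \<open>f\<close> factors through it, \<open>h\<close> kills
      \<open>f\<close>, hence factors through \<open>q\<close> and kills \<open>m\<close>.\<close>
    have "is_mono C (m \<cdot> k)" using mono_comp[OF kH(1) mH(1) kernel_mono[OF k] mm] .
    then obtain h where h: "is_kernel C (m \<cdot> k) h" using mono_normal by blast
    have smk: "src C (m \<cdot> k) = K" using HomD[OF mkH] by simp
    have hH: "h \<in> Hom C Y (tgt C h)" using h HomD[OF mkH] unfolding is_kernel_def Hom_def by auto
    have ho: "tgt C h \<in> obj C" using HomD[OF hH] by blast
    have "h \<cdot> (m \<cdot> k) = zero_arr C K (tgt C h)" using kernelD[OF h hH] smk by simp
    moreover have "f = (m \<cdot> k) \<cdot> e'" using comp_assoc[OF e'(1) kH(1) mH(1)] e' e by simp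
    ultimately have "h \<cdot> f = zero_arr C X (tgt C h)"
      using comp_assoc[OF e'(1) mkH hH] comp_zero_left[OF e'(1) ho] by simp
    then obtain h' where h': "h' \<in> Hom C (tgt C q) (tgt C h)" "h' \<cdot> q = h"
      using cokernelE[OF q f hH] by metis
    have "h \<cdot> m = zero_arr C I (tgt C h)"
      using comp_assoc[OF mH(1) qH(1) h'(1)] h' mH comp_zero_right[OF h'(1)] HomD(4)[OF mH(1)] by simp
    \<comment> \<open>The whole image now lies in \<open>m \<cdot> k\<close>. Cancelling
      \<open>m\<close> gives \<open>k\<close> a right inverse \<open>u\<close>, so
      \<open>g \<cdot> k = 0\<close> forces \<open>g = 0\<close>.\<close>
    then obtain u where u: "u \<in> Hom C I K" "(m \<cdot> k) \<cdot> u = m"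
      using kernelE[OF h hH mH(1)] smk by metis
    have "m \<cdot> (k \<cdot> u) = m \<cdot> ident C I"
      using comp_assoc[OF u(1) kH(1) mH(1)] u ident_right[OF mH(1)] by simp
    then have "k \<cdot> u = ident C I"
      using mm comp_Hom[OF u(1) kH(1)] ident_Hom[OF HomD(4)[OF mH(1)]] unfolding mono_iff[OF mH(1)] by blast
    then have "g = (g \<cdot> k) \<cdot> u"
      using comp_assoc[OF u(1) kH(1) g(1)] ident_right[OF g(1)] by simp
    then show "g = zero_arr C I Z"
      using kH comp_zero_left[OF u(1)] HomD(5)[OF g(1)] by simp
  qed
  then show thesis using that e mH mm by blast
qed

end

section \<open>Finite direct sums\<close>

context preadditive_category
begin

lemma comp_finprod_left:
  assumes h: "h \<in> Hom C X Y" and W: "W \<in> obj C" and A: "finite A"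
    and f: "\<And>i. i \<in> A \<Longrightarrow> f i \<in> Hom C W X"
  shows "h \<cdot> finprod (hom_group C W X) f A = finprod (hom_group C W Y) (\<lambda>i. h \<cdot> f i) A"
proof -
  interpret WX: comm_group "hom_group C W X" using hom_comm_group[OF W HomD(4)[OF h]] .
  interpret WY: comm_group "hom_group C W Y" using hom_comm_group[OF W HomD(5)[OF h]] .
  show ?thesis
    using A f
  proof (induction A)
    case empty
    show ?case
      unfolding WX.finprod_empty WY.finprod_empty
      using comp_zero_right[OF h W] by (simp add: hom_group_def)
  next
    case (insert a A)
    have f: "f \<in> A \<rightarrow> carrier (hom_group C W X)" "f a \<in> carrier (hom_group C W X)"
      using insert.prems by (auto simp: hom_group_def)
    have hf: "h \<cdot> f i \<in> Hom C W Y" if "i \<in> insert a A" for i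
      using comp_Hom[OF insert.prems[OF that] h] .
    have p: "finprod (hom_group C W X) f A \<in> Hom C W X"
      using WX.finprod_closed[OF f(1)] by (simp add: hom_group_def)
    have "h \<cdot> finprod (hom_group C W X) f (insert a A)
        = h \<cdot> (f a \<oplus> finprod (hom_group C W X) f A)"
      using WX.finprod_insert[OF insert.hyps f] by (simp add: hom_group_def)
    also have "\<dots> = h \<cdot> f a \<oplus> h \<cdot> finprod (hom_group C W X) f A"
      using comp_plus_right[OF _ p h] insert.prems by simp
    also have "\<dots> = h \<cdot> f a \<oplus> finprod (hom_group C W Y) (\<lambda>i. h \<cdot> f i) A"
      using insert by simp
    also have "\<dots> = finprod (hom_group C W Y) (\<lambda>i. h \<cdot> f i) (insert a A)"
      using WY.finprod_insert[OF insert.hyps, of "\<lambda>i. h \<cdot> f i"] hf by (simp add: hom_group_def)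
    finally show ?case .
  qed
qed

lemma comp_finprod_right:
  assumes h: "h \<in> Hom C W X" and Y: "Y \<in> obj C" and A: "finite A"
    and f: "\<And>i. i \<in> A \<Longrightarrow> f i \<in> Hom C X Y"
  shows "finprod (hom_group C X Y) f A \<cdot> h = finprod (hom_group C W Y) (\<lambda>i. f i \<cdot> h) A"
proof -
  interpret XY: comm_group "hom_group C X Y" using hom_comm_group[OF HomD(5)[OF h] Y] .
  interpret WY: comm_group "hom_group C W Y" using hom_comm_group[OF HomD(4)[OF h] Y] .
  show ?thesis
    using A f
  proof (induction A)
    case empty
    show ?case
      unfolding XY.finprod_empty WY.finprod_empty
      using comp_zero_left[OF h Y] by (simp add: hom_group_def)
  next
    case (insert a A)
    have f: "f \<in> A \<rightarrow> carrier (hom_group C X Y)" "f a \<in> carrier (hom_group C X Y)"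
      using insert.prems by (auto simp: hom_group_def)
    have hf: "f i \<cdot> h \<in> Hom C W Y" if "i \<in> insert a A" for i
      using comp_Hom[OF h insert.prems[OF that]] .
    have p: "finprod (hom_group C X Y) f A \<in> Hom C X Y"
      using XY.finprod_closed[OF f(1)] by (simp add: hom_group_def)
    have "finprod (hom_group C X Y) f (insert a A) \<cdot> h
        = (f a \<oplus> finprod (hom_group C X Y) f A) \<cdot> h"
      using XY.finprod_insert[OF insert.hyps f] by (simp add: hom_group_def)
    also have "\<dots> = f a \<cdot> h \<oplus> finprod (hom_group C X Y) f A \<cdot> h"
      using comp_plus_left[OF h _ p] insert.prems by simp
    also have "\<dots> = f a \<cdot> h \<oplus> finprod (hom_group C W Y) (\<lambda>i. f i \<cdot> h) A"
      using insert by simp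
    also have "\<dots> = finprod (hom_group C W Y) (\<lambda>i. f i \<cdot> h) (insert a A)"
      using WY.finprod_insert[OF insert.hyps, of "\<lambda>i. f i \<cdot> h"] hf by (simp add: hom_group_def)
    finally show ?case .
  qed
qed

lemma direct_sumD:
  assumes "is_direct_sum C X Xs inc pr"
  shows "X \<in> obj C" "set Xs \<subseteq> obj C"
    and "i < length Xs \<Longrightarrow> inc i \<in> Hom C (Xs ! i) X"
    and "i < length Xs \<Longrightarrow> pr i \<in> Hom C X (Xs ! i)"
    and "i < length Xs \<Longrightarrow> pr i \<cdot> inc i = ident C (Xs ! i)"
    and "i < length Xs \<Longrightarrow> j < length Xs \<Longrightarrow> i \<noteq> j \<Longrightarrow>
      pr j \<cdot> inc i = zero_arr C (Xs ! i) (Xs ! j)"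
    and "finprod (hom_group C X X) (\<lambda>i. inc i \<cdot> pr i) {..<length Xs} = ident C X"
  using assms unfolding is_direct_sum_def by auto

lemma direct_sum_inc_mono:
  "is_direct_sum C X Xs inc pr \<Longrightarrow> i < length Xs \<Longrightarrow> is_mono C (inc i)"
  by (blast intro: retraction_mono dest: direct_sumD(3,4,5))

lemma direct_sum_pr_epi:
  "is_direct_sum C X Xs inc pr \<Longrightarrow> i < length Xs \<Longrightarrow> is_epi C (pr i)"
  by (blast intro: retraction_epi dest: direct_sumD(3,4,5))

text \<open>The identity of \<open>X\<close>, written as the sum of all
  \<open>inc i \<cdot> pr i\<close>, rebuilds an arrow into \<open>X\<close> from its
  components.\<close>

lemma direct_sum_jointly_monic:
  assumes ds: "is_direct_sum C X Xs inc pr"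
    and g: "g \<in> Hom C W X" and h: "h \<in> Hom C W X"
    and eq: "\<And>i. i < length Xs \<Longrightarrow> pr i \<cdot> g = pr i \<cdot> h"
  shows "g = h"
proof -
  note d = direct_sumD[OF ds]
  interpret WX: comm_group "hom_group C W X" using hom_comm_group[OF HomD(4,5)[OF g]] .
  have comp: "k = finprod (hom_group C W X) (\<lambda>i. inc i \<cdot> (pr i \<cdot> k)) {..<length Xs}"
    if k: "k \<in> Hom C W X" for k
  proof -
    have "k = finprod (hom_group C X X) (\<lambda>i. inc i \<cdot> pr i) {..<length Xs} \<cdot> k"
      using d(7) ident_left[OF k] by simp
    also have "\<dots> = finprod (hom_group C W X) (\<lambda>i. (inc i \<cdot> pr i) \<cdot> k) {..<length Xs}"
      using comp_Hom[OF d(4,3)] by (intro comp_finprod_right[OF k d(1)]) auto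
    also have "\<dots> = finprod (hom_group C W X) (\<lambda>i. inc i \<cdot> (pr i \<cdot> k)) {..<length Xs}"
      using comp_assoc[OF k d(4,3)] comp_Hom[OF comp_Hom[OF k d(4)] d(3)]
      by (intro WX.finprod_cong') (auto simp: hom_group_def)
    finally show ?thesis .
  qed
  have "finprod (hom_group C W X) (\<lambda>i. inc i \<cdot> (pr i \<cdot> g)) {..<length Xs}
      = finprod (hom_group C W X) (\<lambda>i. inc i \<cdot> (pr i \<cdot> h)) {..<length Xs}"
    using eq comp_Hom[OF comp_Hom[OF h d(4)] d(3)]
    by (intro WX.finprod_cong') (auto simp: hom_group_def)
  then show ?thesis using comp[OF g] comp[OF h] by simp
qed

lemma direct_sum_Nil:
  assumes "is_zero_obj C X"
  shows "is_direct_sum C X [] inc pr"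
proof -
  have X: "X \<in> obj C" using assms unfolding is_zero_obj_def by blast
  interpret comm_group "hom_group C X X" using hom_comm_group[OF X X] .
  show ?thesis using X zero_obj_iff[OF X] assms
    by (simp add: is_direct_sum_def) (simp add: hom_group_def)
qed

lemma direct_sum_single:
  assumes X: "X \<in> obj C"
  shows "is_direct_sum C X [X] (\<lambda>_. ident C X) (\<lambda>_. ident C X)"
proof -
  interpret comm_group "hom_group C X X" using hom_comm_group[OF X X] .
  have id: "ident C X \<cdot> ident C X = ident C X" using ident_left[OF ident_Hom[OF X]] .
  have "finprod (hom_group C X X) (\<lambda>i. ident C X) {0::nat} = ident C X"
  proof -
    have "ident C X \<in> carrier (hom_group C X X)" using ident_Hom[OF X] by (simp add: hom_group_def)
    then show ?thesis by (simp add: Pi_def)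
  qed
  then show ?thesis using X ident_Hom[OF X] id
    by (simp add: is_direct_sum_def lessThan_Suc)
qed

text \<open>This refines a binary decomposition by decompositions of its two terms, as needed to
  decompose objects by induction. Indices from \<open>length As\<close> on belong to
  \<open>Bs\<close>, shifted.\<close>

lemma direct_sum_append:
  assumes X: "is_direct_sum C X [A, B] inc pr"
    and A: "is_direct_sum C A As incA prA" and B: "is_direct_sum C B Bs incB prB"
  shows "is_direct_sum C X (As @ Bs)
    (\<lambda>i. if i < length As then inc 0 \<cdot> incA i else inc 1 \<cdot> incB (i - length As))
    (\<lambda>i. if i < length As then prA i \<cdot> pr 0 else prB (i - length As) \<cdot> pr 1)"
    (is "is_direct_sum C X _ ?inc ?pr")
proof -
  note a = direct_sumD[OF A] and b = direct_sumD[OF B] and x = direct_sumD[OF X]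
  have inc0: "inc 0 \<in> Hom C A X" and pr0: "pr 0 \<in> Hom C X A" and id0: "pr 0 \<cdot> inc 0 = ident C A"
    and inc1: "inc 1 \<in> Hom C B X" and pr1: "pr 1 \<in> Hom C X B" and id1: "pr 1 \<cdot> inc 1 = ident C B"
    and z10: "pr 1 \<cdot> inc 0 = zero_arr C A B" and z01: "pr 0 \<cdot> inc 1 = zero_arr C B A"
    using x(3)[of 0] x(4)[of 0] x(3)[of 1] x(4)[of 1] x(5)[of 0] x(5)[of 1] x(6)[of 0 1] x(6)[of 1 0]
    by simp_all
  interpret comm_group "hom_group C X X" using hom_comm_group[OF x(1) x(1)] .
  let ?la = "length As" and ?lb = "length Bs"
  have inc: "?inc i \<in> Hom C ((As @ Bs) ! i) X" if "i < ?la + ?lb" for i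
    using that comp_Hom[OF a(3) inc0] comp_Hom[OF b(3) inc1] by (auto simp: nth_append)
  have pr: "?pr i \<in> Hom C X ((As @ Bs) ! i)" if "i < ?la + ?lb" for i
    using that comp_Hom[OF pr0 a(4)] comp_Hom[OF pr1 b(4)] by (auto simp: nth_append)
  \<comment> \<open>Reassociation that exposes the middle composite \<open>q \<cdot> r\<close>; in
    the four cases of \<open>orth\<close> it is an identity or zero.\<close>
  have sandwich: "(p \<cdot> q) \<cdot> (r \<cdot> s) = p \<cdot> ((q \<cdot> r) \<cdot> s)"
    if "s \<in> Hom C V1 V2" "r \<in> Hom C V2 V3" "q \<in> Hom C V3 V4" "p \<in> Hom C V4 V5"
    for p q r s V1 V2 V3 V4 V5
    using comp_assoc[OF comp_Hom[OF that(1,2)] that(3,4)] comp_assoc[OF that(1,2,3)] by simp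
  have orth: "?pr j \<cdot> ?inc i =
      (if i = j then ident C ((As @ Bs) ! i) else zero_arr C ((As @ Bs) ! i) ((As @ Bs) ! j))"
    if i: "i < ?la + ?lb" and j: "j < ?la + ?lb" for i j
  proof (cases "i < ?la"; cases "j < ?la")
    assume ij: "i < ?la" "j < ?la"
    have "(prA j \<cdot> pr 0) \<cdot> (inc 0 \<cdot> incA i) = prA j \<cdot> incA i"
      using sandwich[OF a(3) inc0 pr0 a(4)] ij id0 ident_left[OF a(3)] by simp
    then show ?thesis using ij a(5,6) by (auto simp: nth_append)
  next
    assume ij: "i < ?la" "\<not> j < ?la"
    then have j': "j - ?la < ?lb" using j by simp
    have "(prB (j - ?la) \<cdot> pr 1) \<cdot> (inc 0 \<cdot> incA i) = zero_arr C (As ! i) (Bs ! (j - ?la))"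
      using sandwich[OF a(3)[OF ij(1)] inc0 pr1 b(4)[OF j']] z10
        comp_zero_left[OF a(3)[OF ij(1)] b(1)]
        comp_zero_right[OF b(4)[OF j'] HomD(4)[OF a(3)[OF ij(1)]]] by simp
    then show ?thesis using ij by (auto simp: nth_append)
  next
    assume ij: "\<not> i < ?la" "j < ?la"
    then have i': "i - ?la < ?lb" using i by simp
    have "(prA j \<cdot> pr 0) \<cdot> (inc 1 \<cdot> incB (i - ?la)) = zero_arr C (Bs ! (i - ?la)) (As ! j)"
      using sandwich[OF b(3)[OF i'] inc1 pr0 a(4)[OF ij(2)]] z01
        comp_zero_left[OF b(3)[OF i'] a(1)]
        comp_zero_right[OF a(4)[OF ij(2)] HomD(4)[OF b(3)[OF i']]] by simp
    then show ?thesis using ij by (auto simp: nth_append)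
  next
    assume ij: "\<not> i < ?la" "\<not> j < ?la"
    then have i': "i - ?la < ?lb" and j': "j - ?la < ?lb" using i j by simp_all
    have "(prB (j - ?la) \<cdot> pr 1) \<cdot> (inc 1 \<cdot> incB (i - ?la)) = prB (j - ?la) \<cdot> incB (i - ?la)"
      using sandwich[OF b(3)[OF i'] inc1 pr1 b(4)[OF j']] id1 ident_left[OF b(3)[OF i']] by simp
    moreover have "i - ?la = j - ?la \<longleftrightarrow> i = j" using ij by auto
    ultimately show ?thesis using ij b(5)[OF i'] b(6)[OF i' j'] by (auto simp: nth_append)
  qed
  \<comment> \<open>The identity of \<open>D\<close>, expanded as a sum, is inserted between
    \<open>p\<close> and \<open>q\<close>. It is applied with \<open>A\<close> and with
    \<open>B\<close> as \<open>D\<close>.\<close>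
  have sum: "finprod (hom_group C X X) (\<lambda>i. (p \<cdot> f i) \<cdot> (g i \<cdot> q)) {..<length Ds} = p \<cdot> q"
    if D: "is_direct_sum C D Ds f g" and p: "p \<in> Hom C D X" and q: "q \<in> Hom C X D" for D Ds f g p q
  proof -
    note d = direct_sumD[OF D]
    interpret XD: comm_group "hom_group C X D" using hom_comm_group[OF x(1) d(1)] .
    have fg: "f i \<cdot> g i \<in> Hom C D D" if "i \<in> {..<length Ds}" for i
      using comp_Hom[OF d(4,3)] that by blast
    have "p \<cdot> q = p \<cdot> (finprod (hom_group C D D) (\<lambda>i. f i \<cdot> g i) {..<length Ds} \<cdot> q)"
      using d(7) ident_left[OF q] by simp
    also have "\<dots> = p \<cdot> finprod (hom_group C X D) (\<lambda>i. (f i \<cdot> g i) \<cdot> q) {..<length Ds}"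
      using comp_finprod_right[OF q d(1) finite_lessThan fg] by simp
    also have "\<dots> = finprod (hom_group C X X) (\<lambda>i. p \<cdot> ((f i \<cdot> g i) \<cdot> q)) {..<length Ds}"
      by (rule comp_finprod_left[OF p x(1) finite_lessThan comp_Hom[OF q fg]])
    also have "\<dots> = finprod (hom_group C X X) (\<lambda>i. (p \<cdot> f i) \<cdot> (g i \<cdot> q)) {..<length Ds}"
      using sandwich[OF q d(4,3) p] comp_Hom[OF comp_Hom[OF q d(4)] comp_Hom[OF d(3) p]]
      by (intro finprod_cong') (auto simp: hom_group_def)
    finally show ?thesis by simp
  qed
  define t where "t i = ?inc i \<cdot> ?pr i" for i
  have t: "t i \<in> carrier (hom_group C X X)" if "i < ?la + ?lb" for i
    using comp_Hom[OF pr[OF that] inc[OF that]] by (simp add: hom_group_def t_def)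
  have tA: "t i = (inc 0 \<cdot> incA i) \<cdot> (prA i \<cdot> pr 0)" if "i < ?la" for i
    using that by (simp add: t_def)
  \<comment> \<open>Cut the index range at \<open>length As\<close> and shift the second half back
    to zero, so that \<open>sum\<close> evaluates each half.\<close>
  have split: "{..<?la + ?lb} = {..<?la} \<union> (\<lambda>i. i + ?la) ` {..<?lb}"
  proof (rule equalityI; rule subsetI)
    fix i assume "i \<in> {..<?la + ?lb}"
    then show "i \<in> {..<?la} \<union> (\<lambda>i. i + ?la) ` {..<?lb}"
      by (cases "i < ?la") (auto intro!: image_eqI[of _ _ "i - ?la"])
  qed auto
  have "finprod (hom_group C X X) t {..<?la + ?lb}
      = finprod (hom_group C X X) t {..<?la} \<oplus> finprod (hom_group C X X) t ((\<lambda>i. i + ?la) ` {..<?lb})"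
    unfolding split using t
    by (subst finprod_Un_disjoint) (auto simp: hom_group_def)
  also have "finprod (hom_group C X X) t {..<?la}
      = finprod (hom_group C X X) (\<lambda>i. (inc 0 \<cdot> incA i) \<cdot> (prA i \<cdot> pr 0)) {..<?la}"
    using t tA by (intro finprod_cong') (auto simp flip: tA)
  also have "\<dots> = inc 0 \<cdot> pr 0" using sum[OF A inc0 pr0] .
  also have "finprod (hom_group C X X) t ((\<lambda>i. i + ?la) ` {..<?lb})
      = finprod (hom_group C X X) (\<lambda>i. t (i + ?la)) {..<?lb}"
    using t by (subst finprod_reindex) (auto simp: inj_on_def)
  also have "\<dots> = finprod (hom_group C X X) (\<lambda>i. (inc 1 \<cdot> incB i) \<cdot> (prB i \<cdot> pr 1)) {..<?lb}"
    by (simp add: t_def)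
  also have "\<dots> = inc 1 \<cdot> pr 1" using sum[OF B inc1 pr1] .
  also have "inc 0 \<cdot> pr 0 \<oplus> inc 1 \<cdot> pr 1 = ident C X"
  proof -
    have c: "inc 0 \<cdot> pr 0 \<in> carrier (hom_group C X X)" "inc 1 \<cdot> pr 1 \<in> carrier (hom_group C X X)"
      using comp_Hom[OF pr0 inc0] comp_Hom[OF pr1 inc1] by (simp_all add: hom_group_def)
    have "ident C X = finprod (hom_group C X X) (\<lambda>i. inc i \<cdot> pr i) {0, 1::nat}"
      using x(7) by (simp add: lessThan_Suc insert_commute)
    also have "\<dots> = (inc 0 \<cdot> pr 0) \<otimes>\<^bsub>hom_group C X X\<^esub> (inc 1 \<cdot> pr 1)"
      using c by (simp add: finprod_insert Pi_def)
    finally show ?thesis by (simp add: hom_group_def)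
  qed
  finally show ?thesis
    unfolding is_direct_sum_def t_def using x(1) a(2) b(2) inc pr orth by simp
qed

text \<open>The complement of a retract is the kernel of the retraction.\<close>

lemma direct_sum_of_retract:
  assumes h: "h \<in> Hom C X Y" and r: "r \<in> Hom C Y X" and rh: "r \<cdot> h = ident C X"
    and k: "is_kernel C k r"
  obtains inc pr where "is_direct_sum C Y [X, src C k] inc pr" "inc 0 = h"
proof -
  define K where "K = src C k"
  note kk = kernelD[OF k r, folded K_def]
  have o: "X \<in> obj C" "Y \<in> obj C" "K \<in> obj C" using HomD[OF h] HomD[OF kk(1)] by blast+
  interpret comm_group "hom_group C Y Y" using hom_comm_group[OF o(2,2)] .
  have hr: "h \<cdot> r \<in> Hom C Y Y" using comp_Hom[OF r h] .
  \<comment> \<open>Here \<open>d\<close> is \<open>1 - h \<cdot> r\<close>. It is killed by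
    \<open>r\<close>, hence factors as \<open>k \<cdot> s\<close>, and \<open>s\<close> becomes the
    second projection.\<close>
  obtain d where d: "d \<in> Hom C Y Y" "h \<cdot> r \<oplus> d = ident C Y"
    using diff_ex[OF hr ident_Hom[OF o(2)]] .
  have rhr: "r \<cdot> (h \<cdot> r) = r" using comp_assoc[OF r h r] rh ident_left[OF r] by simp
  have "r \<oplus> r \<cdot> d = r"
    using comp_plus_right[OF hr d(1) r] rhr d(2) ident_right[OF r] by simp
  then have "r \<cdot> d = zero_arr C Y X" using plus_cancel_zero[OF r comp_Hom[OF d(1) r]] by blast
  then obtain s where s: "s \<in> Hom C Y K" "k \<cdot> s = d"
    using kernelE[OF k r d(1)] unfolding K_def by blast
  have km: "is_mono C k" using kernel_mono[OF k] .
  have dh: "d \<cdot> h = zero_arr C X Y"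
  proof (rule plus_cancel_zero[OF h comp_Hom[OF h d(1)]])
    show "h \<oplus> d \<cdot> h = h"
      using comp_plus_left[OF h hr d(1)] comp_assoc[OF h r h] rh ident_right[OF h] d(2) ident_left[OF h]
      by simp
  qed
  have sh: "s \<cdot> h = zero_arr C X K"
    using mono_zeroD[OF kk(1) km comp_Hom[OF h s(1)]] comp_assoc[OF h s(1) kk(1)] s(2) dh by simp
  have "d \<cdot> k = k"
    using comp_plus_left[OF kk(1) hr d(1)] comp_assoc[OF kk(1) r h] kk(2) comp_zero_right[OF h o(3)]
      d(2) ident_left[OF kk(1)] plus_zero(2)[OF comp_Hom[OF kk(1) d(1)]] by simp
  then have "k \<cdot> (s \<cdot> k) = k \<cdot> ident C K"
    using comp_assoc[OF kk(1) s(1) kk(1)] s(2) ident_right[OF kk(1)] by simp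
  then have sk: "s \<cdot> k = ident C K"
    using km comp_Hom[OF kk(1) s(1)] ident_Hom[OF o(3)] unfolding mono_iff[OF kk(1)] by blast
  define inc where "inc i = (if i = (0::nat) then h else k)" for i
  define pr where "pr i = (if i = (0::nat) then r else s)" for i
  have c: "h \<cdot> r \<in> carrier (hom_group C Y Y)" "k \<cdot> s \<in> carrier (hom_group C Y Y)"
    using hr d s by (simp_all add: hom_group_def)
  have "finprod (hom_group C Y Y) (\<lambda>i. inc i \<cdot> pr i) {0, 1} = (h \<cdot> r) \<otimes>\<^bsub>hom_group C Y Y\<^esub> (k \<cdot> s)"
    using c by (simp add: finprod_insert Pi_def inc_def pr_def)
  then have "finprod (hom_group C Y Y) (\<lambda>i. inc i \<cdot> pr i) {..<2} = ident C Y"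
    using s d by (simp add: hom_group_def numeral_2_eq_2 lessThan_Suc insert_commute)
  then have "is_direct_sum C Y [X, K] inc pr"
    unfolding is_direct_sum_def using o h r kk s rh sk sh
    by (auto simp: inc_def pr_def less_Suc_eq nth_Cons' numeral_2_eq_2)
  then show thesis using that unfolding K_def by (simp add: inc_def)
qed

end

context abelian_category
begin

text \<open>\<open>X\<close> is a summand of \<open>Y\<close> with complement the kernel of
  \<open>r\<close>. Indecomposability kills the complement, so the split epimorphism
  \<open>r\<close> is also mono, and \<open>h\<close> is its inverse.\<close>

lemma indecomposable_retract:
  assumes X: "\<not> is_zero_obj C X" and Y: "indecomposable C Y"
    and h: "h \<in> Hom C X Y" and r: "r \<in> Hom C Y X" and rh: "r \<cdot> h = ident C X"
  shows "is_iso C h"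
proof -
  obtain k where k: "is_kernel C k r" using kernel_ex HomD(1)[OF r] by blast
  obtain inc pr where "is_direct_sum C Y [X, src C k] inc pr"
    using direct_sum_of_retract[OF h r rh k] by blast
  then have K: "is_zero_obj C (src C k)" using X Y unfolding indecomposable_def by blast
  have "is_mono C r"
  proof (rule mono_zeroI[OF r])
    fix W g assume g: "g \<in> Hom C W Y" "r \<cdot> g = zero_arr C W X"
    obtain u where u: "u \<in> Hom C W (src C k)" "k \<cdot> u = g" using kernelE[OF k r g] .
    then show "g = zero_arr C W Y"
      using zero_obj_Hom(1)[OF K u(1)] comp_zero_right[OF kernelD(1)[OF k r] HomD(4)[OF g(1)]] by simp
  qed
  then have "is_iso C r" using mono_epi_iso[OF r] retraction_epi[OF h r rh] by blast
  then obtain r' where r': "r' \<in> Hom C X Y" "is_iso C r'" "r' \<cdot> r = ident C Y"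
    using isoE[OF r] by metis
  have "h = r'"
    using comp_assoc[OF h r r'(1)] r'(3) rh ident_left[OF h] ident_right[OF r'(1)] by simp
  then show ?thesis using r' by simp
qed

end

section \<open>Length\<close>

definition has_series :: "('o, 'm, 'z) precat_scheme \<Rightarrow> nat \<Rightarrow> 'o \<Rightarrow> bool" where
  "has_series C n X \<longleftrightarrow> (\<exists>F f. is_composition_series C X n F f)"

lemma has_series_0: "has_series C 0 X \<longleftrightarrow> is_zero_obj C X"
  by (auto simp: has_series_def is_composition_series_def)

text \<open>Cutting off or adding the top term of a series gives the recursion on which all
  inductions over series run.\<close>

lemma has_series_Suc:
  "has_series C (Suc n) X \<longleftrightarrow> (\<exists>X' k q. has_series C n X' \<and> k \<in> Hom C X' X \<and> is_mono C k \<and>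
    is_cokernel C q k \<and> is_simple C (tgt C q))"
proof
  assume "has_series C (Suc n) X"
  then obtain F f where F: "is_composition_series C X (Suc n) F f" by (auto simp: has_series_def)
  then have "is_composition_series C (F n) n F f" by (auto simp: is_composition_series_def)
  then have "has_series C n (F n)" unfolding has_series_def by blast
  moreover have "f n \<in> Hom C (F n) X \<and> is_mono C (f n) \<and> (\<exists>q. is_cokernel C q (f n) \<and> is_simple C (tgt C q))"
    using F unfolding is_composition_series_def by blast
  ultimately show "\<exists>X' k q. has_series C n X' \<and> k \<in> Hom C X' X \<and> is_mono C k \<and>
      is_cokernel C q k \<and> is_simple C (tgt C q)"
    by blast
next
  assume "\<exists>X' k q. has_series C n X' \<and> k \<in> Hom C X' X \<and> is_mono C k \<and>
      is_cokernel C q k \<and> is_simple C (tgt C q)"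
  then obtain F f k q where "is_composition_series C (F n) n F f" "k \<in> Hom C (F n) X" "is_mono C k"
      "is_cokernel C q k" "is_simple C (tgt C q)"
    by (auto simp: has_series_def is_composition_series_def)
  then have "is_composition_series C X (Suc n) (F(Suc n := X)) (f(n := k))"
    by (auto simp: is_composition_series_def less_Suc_eq)
  then show "has_series C (Suc n) X" by (auto simp: has_series_def)
qed

section \<open>Simple objects, and composition series along monomorphisms and epimorphisms\<close>

context abelian_category
begin

text \<open>The image of \<open>f\<close> is a subobject of \<open>S\<close>, hence zero or all of
  \<open>S\<close>, and a zero image would make \<open>f\<close> zero.\<close>

lemma simple_epi:
  assumes S: "is_simple C S" and f: "f \<in> Hom C X S" and nz: "f \<noteq> zero_arr C X S"
  shows "is_epi C f"
proof -
  obtain I e m where em: "e \<in> Hom C X I" "m \<in> Hom C I S" "is_epi C e" "is_mono C m" "m \<cdot> e = f"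
    using epi_mono_factorization[OF f] .
  have "is_zero_obj C I \<or> is_iso C m"
    using S em(4) HomD(2,3)[OF em(2)] unfolding is_simple_def by blast
  moreover have "\<not> is_zero_obj C I"
  proof
    assume "is_zero_obj C I"
    then have "e = zero_arr C X I" using zero_obj_Hom(1) em(1) by blast
    then show False using comp_zero_right[OF em(2) HomD(4)[OF f]] em(5) nz by simp
  qed
  ultimately have "is_epi C m" using iso_epi by blast
  then show ?thesis using epi_comp[OF em(1,2,3)] em(5) by blast
qed

text \<open>The kernel of \<open>f\<close> is zero or all of \<open>S\<close>, and the latter would
  make \<open>f\<close> zero.\<close>

lemma simple_mono:
  assumes S: "is_simple C S" and f: "f \<in> Hom C S X" and nz: "f \<noteq> zero_arr C S X"
  shows "is_mono C f"
proof -
  obtain k where k: "is_kernel C k f" using kernel_ex HomD(1)[OF f] by blast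
  note kk = kernelD[OF k f]
  have "is_zero_obj C (src C k) \<or> is_iso C k"
    using S kernel_mono[OF k] HomD(3)[OF kk(1)] unfolding is_simple_def by blast
  moreover have "\<not> is_iso C k"
  proof
    assume "is_iso C k"
    then have "f = zero_arr C S X" using epi_zeroD[OF kk(1) iso_epi f kk(2)] by blast
    then show False using nz by blast
  qed
  ultimately have K: "is_zero_obj C (src C k)" by blast
  show ?thesis
  proof (rule mono_zeroI[OF f])
    fix W g assume g: "g \<in> Hom C W S" "f \<cdot> g = zero_arr C W X"
    obtain u where u: "u \<in> Hom C W (src C k)" "k \<cdot> u = g" using kernelE[OF k f g] .
    then show "g = zero_arr C W S"
      using zero_obj_Hom(1)[OF K u(1)] comp_zero_right[OF kk(1) HomD(4)[OF g(1)]] by simp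
  qed
qed

lemma simple_iso:
  assumes S: "is_simple C S" and i: "i \<in> Hom C S T" "is_iso C i"
  shows "is_simple C T"
proof -
  obtain j where j: "j \<in> Hom C T S" "is_iso C j" "j \<cdot> i = ident C S" "i \<cdot> j = ident C T"
    using isoE[OF i] .
  have "is_zero_obj C (src C f) \<or> is_iso C f" if f: "is_mono C f" "tgt C f = T" for f
  proof -
    have fH: "f \<in> Hom C (src C f) T" using f arr_Hom[of f] unfolding is_mono_def by simp
    have jf: "j \<cdot> f \<in> Hom C (src C f) S" using comp_Hom[OF fH j(1)] .
    have "is_mono C (j \<cdot> f)" using mono_comp[OF fH j(1) f(1) iso_mono[OF j(2)]] .
    then have "is_zero_obj C (src C f) \<or> is_iso C (j \<cdot> f)"
      using S HomD(2,3)[OF jf] unfolding is_simple_def by metis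
    moreover have "i \<cdot> (j \<cdot> f) = f" using comp_assoc[OF fH j(1) i(1)] j(4) ident_left[OF fH] by simp
    ultimately show ?thesis using iso_comp[OF jf i(1) _ i(2)] by auto
  qed
  moreover have "\<not> is_zero_obj C T"
    using S mono_into_zero_obj[OF i(1) iso_mono[OF i(2)]] unfolding is_simple_def by blast
  ultimately show ?thesis using HomD(5)[OF i(1)] unfolding is_simple_def by blast
qed

text \<open>Induction along the series of \<open>Y\<close>: intersect \<open>X\<close> with the
  next-to-top term \<open>Y'\<close>. If \<open>X\<close> does not lie in \<open>Y'\<close>, the
  quotient of \<open>X\<close> by the intersection is the simple top factor \<open>S\<close>, so
  both sides lose one step.\<close>

lemma series_mono:
  assumes "has_series C n Y" "f \<in> Hom C X Y" "is_mono C f"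
  shows "\<exists>m\<le>n. has_series C m X \<and> (is_iso C f \<or> m < n)"
  using assms
proof (induction n arbitrary: X Y f)
  case 0
  then have "is_zero_obj C Y" "is_zero_obj C X" using mono_into_zero_obj[OF 0(2,3)] by (auto simp: has_series_0)
  then show ?case using zero_obj_iso[OF 0(2)] by (auto simp: has_series_0)
next
  case (Suc n)
  note f = Suc.prems(2,3)
  obtain Y' k q where Y': "has_series C n Y'" and k: "k \<in> Hom C Y' Y" "is_mono C k"
    and q: "is_cokernel C q k" and S: "is_simple C (tgt C q)"
    using Suc.prems(1) unfolding has_series_Suc by blast
  define S where "S = tgt C q"
  have qH: "q \<in> Hom C Y S" "q \<cdot> k = zero_arr C Y' S" using cokernelD[OF q k(1)] unfolding S_def by auto
  have kq: "is_kernel C k q" using mono_kernel_of_cokernel[OF k(2) q] .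
  have sk: "src C k = Y'" using HomD(2)[OF k(1)] .
  have qf: "q \<cdot> f \<in> Hom C X S" using comp_Hom[OF f(1) qH(1)] .
  show ?case
  proof (cases "q \<cdot> f = zero_arr C X S")
    case True
    \<comment> \<open>\<open>X\<close> lies in \<open>Y'\<close>, and the strict drop is automatic
      because \<open>m \<le> n < Suc n\<close>.\<close>
    obtain u where u: "u \<in> Hom C X Y'" "k \<cdot> u = f" using kernelE[OF kq qH(1) f(1) True] sk by metis
    have "is_mono C u" using mono_cancel[OF u(1) k(1)] u(2) f(2) by simp
    then show ?thesis using Suc.IH[OF Y' u(1)] le_imp_less_Suc less_imp_le by metis
  next
    case False
    have e: "is_epi C (q \<cdot> f)" using simple_epi[OF _ qf False] S unfolding S_def by blast
    \<comment> \<open>The kernel of \<open>q \<cdot> f\<close> is the intersection of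
      \<open>X\<close> with \<open>Y'\<close>; its quotient is \<open>S\<close> because
      \<open>q \<cdot> f\<close> is epi.\<close>
    obtain j where j: "is_kernel C j (q \<cdot> f)" using kernel_ex HomD(1)[OF qf] by blast
    define X' where "X' = src C j"
    have jH: "j \<in> Hom C X' X" "(q \<cdot> f) \<cdot> j = zero_arr C X' S"
      using kernelD[OF j qf] unfolding X'_def by auto
    have fj: "f \<cdot> j \<in> Hom C X' Y" using comp_Hom[OF jH(1) f(1)] .
    have "q \<cdot> (f \<cdot> j) = zero_arr C X' S" using comp_assoc[OF jH(1) f(1) qH(1)] jH(2) by simp
    then obtain v where v: "v \<in> Hom C X' Y'" "k \<cdot> v = f \<cdot> j"
      using kernelE[OF kq qH(1) fj] sk by metis
    have "is_mono C (f \<cdot> j)" using mono_comp[OF jH(1) f(1) kernel_mono[OF j] f(2)] .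
    then have "is_mono C v" using mono_cancel[OF v(1) k(1)] v(2) by simp
    then obtain m where m: "m \<le> n" "has_series C m X'" "is_iso C v \<or> m < n"
      using Suc.IH[OF Y' v(1)] by blast
    have "is_simple C (tgt C (q \<cdot> f))" using S HomD(3)[OF qf] unfolding S_def by simp
    then have "has_series C (Suc m) X"
      unfolding has_series_Suc using m(2) jH(1) kernel_mono[OF j] epi_cokernel_of_kernel[OF e j] by blast
    \<comment> \<open>If the intersection is all of \<open>Y'\<close>, an arrow \<open>g\<close>
      killing \<open>f\<close> also kills \<open>k\<close>, so it factors through \<open>q\<close>;
      as \<open>q \<cdot> f\<close> is epi, the factor vanishes.\<close>
    moreover have "is_iso C f" if v': "is_iso C v"
    proof (rule mono_epi_iso[OF f], rule epi_zeroI[OF f(1)])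
      fix Z g assume g: "g \<in> Hom C Y Z" "g \<cdot> f = zero_arr C X Z"
      have gk: "g \<cdot> k \<in> Hom C Y' Z" using comp_Hom[OF k(1) g(1)] .
      have "(g \<cdot> k) \<cdot> v = zero_arr C X' Z"
        using comp_assoc[OF v(1) k(1) g(1)] comp_assoc[OF jH(1) f(1) g(1)] v(2) g(2)
          comp_zero_left[OF jH(1) HomD(5)[OF g(1)]] by simp
      then have "g \<cdot> k = zero_arr C Y' Z" using epi_zeroD[OF v(1) iso_epi[OF v'] gk] by blast
      then obtain h where h: "h \<in> Hom C S Z" "h \<cdot> q = g"
        using cokernelE[OF q k(1) g(1)] unfolding S_def by blast
      have "h \<cdot> (q \<cdot> f) = zero_arr C X Z" using comp_assoc[OF f(1) qH(1) h(1)] h(2) g(2) by simp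
      then have "h = zero_arr C S Z" using epi_zeroD[OF qf e h(1)] by blast
      then show "g = zero_arr C Y Z" using h(2) comp_zero_left[OF qH(1) HomD(5)[OF g(1)]] by simp
    qed
    ultimately show ?thesis using m by (intro exI[of _ "Suc m"]) auto
  qed
qed

text \<open>Induction along the series of \<open>X\<close>: let \<open>Y'\<close> be the image in
  \<open>Y\<close> of the next-to-top term \<open>X'\<close>. The quotient \<open>T\<close> of
  \<open>Y\<close> by \<open>Y'\<close> is a quotient of the simple top factor \<open>S\<close>,
  hence zero or isomorphic to \<open>S\<close>.\<close>

lemma series_epi:
  assumes "has_series C n X" "p \<in> Hom C X Y" "is_epi C p"
  shows "\<exists>m\<le>n. has_series C m Y \<and> (is_iso C p \<or> m < n)"
  using assms
proof (induction n arbitrary: X Y p)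
  case 0
  then have "is_zero_obj C X" "is_zero_obj C Y" using epi_from_zero_obj[OF 0(2,3)] by (auto simp: has_series_0)
  then show ?case using zero_obj_iso[OF 0(2)] by (auto simp: has_series_0)
next
  case (Suc n)
  note p = Suc.prems(2,3)
  obtain X' k q where X': "has_series C n X'" and k: "k \<in> Hom C X' X" "is_mono C k"
    and q: "is_cokernel C q k" and S: "is_simple C (tgt C q)"
    using Suc.prems(1) unfolding has_series_Suc by blast
  define S where "S = tgt C q"
  have qH: "q \<in> Hom C X S" "q \<cdot> k = zero_arr C X' S" using cokernelD[OF q k(1)] unfolding S_def by auto
  have pk: "p \<cdot> k \<in> Hom C X' Y" using comp_Hom[OF k(1) p(1)] .
  obtain Y' e m where em: "e \<in> Hom C X' Y'" "m \<in> Hom C Y' Y" "is_epi C e" "is_mono C m" "m \<cdot> e = p \<cdot> k"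
    using epi_mono_factorization[OF pk] .
  obtain i where i: "i \<le> n" "has_series C i Y'" "is_iso C e \<or> i < n"
    using Suc.IH[OF X' em(1,3)] by blast
  obtain c where c: "is_cokernel C c m" using cokernel_ex HomD(1)[OF em(2)] by blast
  define T where "T = tgt C c"
  have cH: "c \<in> Hom C Y T" "c \<cdot> m = zero_arr C Y' T" using cokernelD[OF c em(2)] unfolding T_def by auto
  have cp: "c \<cdot> p \<in> Hom C X T" using comp_Hom[OF p(1) cH(1)] .
  have "(c \<cdot> p) \<cdot> k = (c \<cdot> m) \<cdot> e"
    using comp_assoc[OF k(1) p(1) cH(1)] comp_assoc[OF em(1,2) cH(1)] em(5) by simp
  then have "(c \<cdot> p) \<cdot> k = zero_arr C X' T"
    using cH(2) comp_zero_left[OF em(1) HomD(5)[OF cH(1)]] by simp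
  then obtain t where t: "t \<in> Hom C S T" "t \<cdot> q = c \<cdot> p"
    using cokernelE[OF q k(1) cp] unfolding S_def by blast
  have cpe: "is_epi C (c \<cdot> p)" using epi_comp[OF p(1) cH(1) p(2) cokernel_epi[OF c]] .
  show ?case
  proof (cases "t = zero_arr C S T")
    case True
    then have "c \<cdot> p = zero_arr C X T" using t(2) comp_zero_left[OF qH(1) HomD(5)[OF t(1)]] by simp
    then have "c = zero_arr C Y T" using epi_zeroD[OF p cH(1)] by blast
    have "is_epi C m"
    proof (rule epi_zeroI[OF em(2)])
      fix Z g assume g: "g \<in> Hom C Y Z" "g \<cdot> m = zero_arr C Y' Z"
      obtain u where u: "u \<in> Hom C T Z" "u \<cdot> c = g" using cokernelE[OF c em(2) g] unfolding T_def .
      then show "g = zero_arr C Y Z"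
        using \<open>c = zero_arr C Y T\<close> comp_zero_right[OF u(1) HomD(4)[OF g(1)]] by simp
    qed
    then have "is_iso C m" using mono_epi_iso[OF em(2,4)] by blast
    then obtain m' where "m' \<in> Hom C Y Y'" "is_iso C m'" using isoE[OF em(2)] by metis
    \<comment> \<open>The quotient is zero, so \<open>m\<close> is invertible, and
      \<open>series_mono\<close> along its inverse carries the series of \<open>Y'\<close> over to
      \<open>Y\<close>.\<close>
    then obtain l where "l \<le> i" "has_series C l Y" using series_mono[OF i(2)] iso_mono by blast
    then show ?thesis using i(1) by (intro exI[of _ l]) auto
  next
    case False
    have tm: "is_mono C t" using simple_mono[OF _ t(1) False] S unfolding S_def by blast
    have "is_epi C t"
    proof (rule epi_zeroI[OF t(1)])
      fix Z g assume g: "g \<in> Hom C T Z" "g \<cdot> t = zero_arr C S Z"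
      have "g \<cdot> (c \<cdot> p) = zero_arr C X Z"
        using comp_assoc[OF qH(1) t(1) g(1)] g(2) t(2) comp_zero_left[OF qH(1) HomD(5)[OF g(1)]] by simp
      then show "g = zero_arr C T Z" using epi_zeroD[OF cp cpe g(1)] by blast
    qed
    then have "is_simple C T"
      using simple_iso[OF _ t(1)] mono_epi_iso[OF t(1) tm] S unfolding S_def by blast
    then have "has_series C (Suc i) Y"
      unfolding has_series_Suc T_def using i(2) em(2,4) c by blast
    \<comment> \<open>An arrow \<open>x\<close> killed by \<open>p\<close> has
      \<open>t \<cdot> (q \<cdot> x) = 0\<close>, and \<open>t\<close> is mono, so \<open>q\<close>
      kills \<open>x\<close>. Thus \<open>x\<close> comes from \<open>X'\<close>, where
      \<open>m \<cdot> e\<close> is mono.\<close>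
    moreover have "is_iso C p" if e': "is_iso C e"
    proof (rule mono_epi_iso[OF p(1) _ p(2)], rule mono_zeroI[OF p(1)])
      fix W x assume x: "x \<in> Hom C W X" "p \<cdot> x = zero_arr C W Y"
      have qx: "q \<cdot> x \<in> Hom C W S" using comp_Hom[OF x(1) qH(1)] .
      have "t \<cdot> (q \<cdot> x) = zero_arr C W T"
        using comp_assoc[OF x(1) qH(1) t(1)] t(2) comp_assoc[OF x(1) p(1) cH(1)] x(2)
          comp_zero_right[OF cH(1) HomD(4)[OF x(1)]] by simp
      then have "q \<cdot> x = zero_arr C W S" using mono_zeroD[OF t(1) tm qx] by blast
      then obtain y where y: "y \<in> Hom C W X'" "k \<cdot> y = x"
        using kernelE[OF mono_kernel_of_cokernel[OF k(2) q] qH(1) x(1)] HomD(2)[OF k(1)] by metis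
      have "m \<cdot> (e \<cdot> y) = zero_arr C W Y"
        using comp_assoc[OF y(1) em(1,2)] em(5) comp_assoc[OF y(1) k(1) p(1)] y(2) x(2) by simp
      then have "e \<cdot> y = zero_arr C W Y'" using mono_zeroD[OF em(2,4) comp_Hom[OF y(1) em(1)]] by blast
      then have "y = zero_arr C W X'" using mono_zeroD[OF em(1) iso_mono[OF e'] y(1)] by blast
      then show "x = zero_arr C W X" using y(2) comp_zero_right[OF k(1) HomD(4)[OF x(1)]] by simp
    qed
    ultimately show ?thesis using i by (intro exI[of _ "Suc i"]) auto
  qed
qed

end

section \<open>The length function and decompositions into indecomposables\<close>

context abelian_length_category
begin

lemma comp_length_series:
  assumes "X \<in> obj C"
  shows "has_series C (comp_length C X) X"
  using finite_length[OF assms] LeastI_ex[of "\<lambda>n. has_series C n X"]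
  unfolding finite_length_def comp_length_def has_series_def by blast

lemma comp_length_le: "has_series C n X \<Longrightarrow> comp_length C X \<le> n"
  unfolding comp_length_def has_series_def by (rule Least_le)

lemma comp_length_mono:
  assumes "f \<in> Hom C X Y" "is_mono C f"
  shows "comp_length C X \<le> comp_length C Y"
    and "\<not> is_iso C f \<Longrightarrow> comp_length C X < comp_length C Y"
  using series_mono[OF comp_length_series[OF HomD(5)[OF assms(1)]] assms] comp_length_le
  by (blast intro: le_trans le_less_trans)+

lemma comp_length_epi:
  assumes "p \<in> Hom C X Y" "is_epi C p"
  shows "\<not> is_iso C p \<Longrightarrow> comp_length C Y < comp_length C X"
  using series_epi[OF comp_length_series[OF HomD(4)[OF assms(1)]] assms] comp_length_le
  by (blast intro: le_less_trans)

lemma comp_length_sub: "sub C X Y \<Longrightarrow> comp_length C X \<le> comp_length C Y"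
  unfolding sub_def using comp_length_mono(1) by blast

lemma comp_length_isomorphic: "isomorphic C X Y \<Longrightarrow> comp_length C X = comp_length C Y"
  by (intro antisym comp_length_sub isomorphic_sub) (auto intro: isomorphic_sym)

lemma comp_length_strict_sub:
  "strict_sub C X Y \<Longrightarrow> comp_length C X < comp_length C Y"
  unfolding strict_sub_def sub_def isomorphic_def using comp_length_mono(2) by blast

text \<open>A proper monomorphism makes the lengths differ, which excludes any other arrow from
  being an isomorphism between \<open>X\<close> and \<open>Y\<close>.\<close>

lemma mono_strict_sub:
  assumes "f \<in> Hom C X Y" "is_mono C f" "\<not> is_iso C f"
  shows "strict_sub C X Y"
  using assms comp_length_mono(2)[OF assms] comp_length_isomorphic[of X Y]
  unfolding strict_sub_def sub_def by auto

text \<open>If the objects were not isomorphic, the first relation would make \<open>X\<close>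
  strictly shorter than \<open>Y\<close>, against the second.\<close>

lemma sub_antisym: "sub C X Y \<Longrightarrow> sub C Y X \<Longrightarrow> isomorphic C X Y"
  using comp_length_strict_sub[of X Y] comp_length_sub[of Y X] unfolding strict_sub_def by fastforce

text \<open>Induction on length: both terms of a nontrivial splitting are proper subobjects, hence
  shorter.\<close>

lemma indecomposable_decomposition:
  assumes "X \<in> obj C"
  obtains Xs inc pr where "is_direct_sum C X Xs inc pr" "\<forall>Y\<in>set Xs. indecomposable C Y"
proof -
  have "\<exists>Xs inc pr. is_direct_sum C X Xs inc pr \<and> (\<forall>Y\<in>set Xs. indecomposable C Y)"
    using assms
  proof (induction "comp_length C X" arbitrary: X rule: less_induct)
    case less
    consider "is_zero_obj C X" | "indecomposable C X"
      | A B inc pr where "is_direct_sum C X [A, B] inc pr" "\<not> is_zero_obj C A" "\<not> is_zero_obj C B"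
      using less.prems unfolding indecomposable_def by blast
    then show ?case
    proof cases
      case 1
      then show ?thesis using direct_sum_Nil[OF 1] by (intro exI[of _ "[]"]) auto
    next
      case 2
      then show ?thesis using direct_sum_single[OF less.prems] by (intro exI[of _ "[X]"]) auto
    next
      case 3
      note d = direct_sumD[OF 3(1)]
      have ob: "A \<in> obj C" "B \<in> obj C" using d(2) by auto
      have inc0: "inc 0 \<in> Hom C A X" and pr0: "pr 0 \<in> Hom C X A" and id0: "pr 0 \<cdot> inc 0 = ident C A"
        and inc1: "inc 1 \<in> Hom C B X" and pr1: "pr 1 \<in> Hom C X B" and id1: "pr 1 \<cdot> inc 1 = ident C B"
        and z10: "pr 1 \<cdot> inc 0 = zero_arr C A B" and z01: "pr 0 \<cdot> inc 1 = zero_arr C B A"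
        using d(3)[of 0] d(4)[of 0] d(3)[of 1] d(4)[of 1] d(5)[of 0] d(5)[of 1] d(6)[of 0 1] d(6)[of 1 0]
        by simp_all
      \<comment> \<open>An invertible \<open>inc 0\<close> is epi and is killed by
        \<open>pr 1\<close>, so \<open>pr 1\<close> is zero; then the identity
        \<open>pr 1 \<cdot> inc 1\<close> of \<open>B\<close> is zero too.\<close>
      have "\<not> is_iso C (inc 0)"
      proof
        assume "is_iso C (inc 0)"
        then have "pr 1 = zero_arr C X B" using epi_zeroD[OF inc0 iso_epi pr1 z10] by blast
        then have "is_zero_obj C B"
          using id1 comp_zero_left[OF inc1 ob(2)] zero_obj_iff[OF ob(2)] by simp
        then show False using 3(3) by blast
      qed
      moreover have "\<not> is_iso C (inc 1)"
      proof
        assume "is_iso C (inc 1)"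
        then have "pr 0 = zero_arr C X A" using epi_zeroD[OF inc1 iso_epi pr0 z01] by blast
        then have "is_zero_obj C A"
          using id0 comp_zero_left[OF inc0 ob(1)] zero_obj_iff[OF ob(1)] by simp
        then show False using 3(2) by blast
      qed
      ultimately have "comp_length C A < comp_length C X" "comp_length C B < comp_length C X"
        using comp_length_mono(2)[OF inc0 retraction_mono[OF inc0 pr0 id0]]
          comp_length_mono(2)[OF inc1 retraction_mono[OF inc1 pr1 id1]] by blast+
      then obtain As incA prA Bs incB prB
        where A: "is_direct_sum C A As incA prA" "\<forall>Y\<in>set As. indecomposable C Y"
          and B: "is_direct_sum C B Bs incB prB" "\<forall>Y\<in>set Bs. indecomposable C Y"
        using less.hyps ob by meson
      have "\<forall>Y\<in>set (As @ Bs). indecomposable C Y" using A(2) B(2) by auto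
      then show ?thesis using direct_sum_append[OF 3(1) A(1) B(1)] by blast
    qed
  qed
  then show thesis using that by blast
qed

end

section \<open>The lexicographic order and the Gabriel-Roiter property\<close>

text \<open>Strict form of \<open>lex_le\<close>: the witness \<open>m\<close> is the smallest
  element of the symmetric difference, and it lies in \<open>B\<close>.\<close>

definition lex_less :: "nat set \<Rightarrow> nat set \<Rightarrow> bool" where
  "lex_less A B \<longleftrightarrow> (\<exists>m\<in>B - A. \<forall>k<m. k \<in> A \<longleftrightarrow> k \<in> B)"

lemma INF_enat_le_iff: "(INF m\<in>S. enat m) \<le> enat n \<longleftrightarrow> (\<exists>m\<in>S. m \<le> n)"
proof
  assume le: "(INF m\<in>S. enat m) \<le> enat n"
  show "\<exists>m\<in>S. m \<le> n"
  proof (rule ccontr)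
    assume "\<not> (\<exists>m\<in>S. m \<le> n)"
    \<comment> \<open>If all members exceed \<open>n\<close>, then \<open>Suc n\<close> is a lower
      bound; this includes empty \<open>S\<close>, whose infimum is infinite.\<close>
    then have "enat (Suc n) \<le> (INF m\<in>S. enat m)" by (intro INF_greatest) auto
    then show False using le order.trans by fastforce
  qed
next
  assume "\<exists>m\<in>S. m \<le> n"
  then show "(INF m\<in>S. enat m) \<le> enat n" by (auto intro: INF_lower2)
qed

text \<open>Comparing the two minima amounts to asking that every element of \<open>A - B\<close> be
  preceded by one of \<open>B - A\<close>. For distinct sets the least element of
  \<open>B - A\<close> is then the first difference.\<close>

lemma lex_le_iff: "lex_le A B \<longleftrightarrow> A = B \<or> lex_less A B"
proof -
  have "lex_le A B \<longleftrightarrow> (\<forall>n\<in>A - B. \<exists>m\<in>B - A. m \<le> n)"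
    unfolding lex_le_def le_INF_iff INF_enat_le_iff by blast
  also have "\<dots> \<longleftrightarrow> A = B \<or> lex_less A B"
  proof (intro iffI disjCI)
    assume *: "\<forall>n\<in>A - B. \<exists>m\<in>B - A. m \<le> n" and "\<not> lex_less A B"
    show "A = B"
    proof (rule ccontr)
      assume "A \<noteq> B"
      then have ne: "\<exists>m. m \<in> B - A" using * by blast
      define m where "m = (LEAST m. m \<in> B - A)"
      have m: "m \<in> B - A" using LeastI_ex[OF ne] unfolding m_def .
      have min: "k \<notin> B - A" if "k < m" for k using not_less_Least that unfolding m_def by blast
      \<comment> \<open>An element of \<open>A - B\<close> below \<open>m\<close> would by the
        assumption force an element of \<open>B - A\<close> below \<open>m\<close>.\<close>
      have "k \<in> A \<longleftrightarrow> k \<in> B" if "k < m" for k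
        using min * that le_less_trans by blast
      then show False using m \<open>\<not> lex_less A B\<close> unfolding lex_less_def by blast
    qed
  next
    assume "A = B \<or> lex_less A B"
    then show "\<forall>n\<in>A - B. \<exists>m\<in>B - A. m \<le> n"
      unfolding lex_less_def by (meson DiffD1 DiffD2 not_le)
  qed
  finally show ?thesis .
qed

text \<open>The smaller of the two deciding elements decides between \<open>A\<close> and
  \<open>D\<close>.\<close>

lemma lex_less_trans:
  assumes "lex_less A B" "lex_less B D"
  shows "lex_less A D"
proof -
  obtain m where m: "m \<in> B - A" "\<forall>k<m. k \<in> A \<longleftrightarrow> k \<in> B" using assms(1) unfolding lex_less_def by blast
  obtain n where n: "n \<in> D - B" "\<forall>k<n. k \<in> B \<longleftrightarrow> k \<in> D" using assms(2) unfolding lex_less_def by blast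
  have "min m n \<in> D - A" using m n by (cases m n rule: linorder_cases) auto
  moreover have "\<forall>k<min m n. k \<in> A \<longleftrightarrow> k \<in> D" using m n by simp
  ultimately show ?thesis unfolding lex_less_def by blast
qed

lemma lex_less_irrefl: "\<not> lex_less A A"
  by (simp add: lex_less_def)

lemma lex_less_linear: "A = B \<or> lex_less A B \<or> lex_less B A"
proof (rule ccontr)
  assume *: "\<not> (A = B \<or> lex_less A B \<or> lex_less B A)"
  then have ne: "\<exists>m. (m \<in> A) \<noteq> (m \<in> B)" by blast
  define m where "m = (LEAST m. (m \<in> A) \<noteq> (m \<in> B))"
  have m: "(m \<in> A) \<noteq> (m \<in> B)" using LeastI_ex[OF ne] unfolding m_def .
  have min: "k \<in> A \<longleftrightarrow> k \<in> B" if "k < m" for k using not_less_Least that unfolding m_def by blast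
  then show False using m * unfolding lex_less_def by blast
qed

lemma lex_le_refl: "lex_le A A"
  by (simp add: lex_le_iff)

lemma lex_le_trans: "lex_le A B \<Longrightarrow> lex_le B D \<Longrightarrow> lex_le A D"
  unfolding lex_le_iff using lex_less_trans by blast

lemma lex_less_le_trans: "lex_less A B \<Longrightarrow> lex_le B D \<Longrightarrow> lex_less A D"
  unfolding lex_le_iff using lex_less_trans by blast

lemma lex_le_less_trans: "lex_le A B \<Longrightarrow> lex_less B D \<Longrightarrow> lex_less A D"
  unfolding lex_le_iff using lex_less_trans by blast

lemma lex_le_antisym: "lex_le A B \<Longrightarrow> lex_le B A \<Longrightarrow> A = B"
  unfolding lex_le_iff using lex_less_trans lex_less_irrefl by blast

lemma lex_le_linear: "lex_le A B \<or> lex_le B A"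
  unfolding lex_le_iff using lex_less_linear by blast

lemma lex_le_empty: "lex_le {} A"
  by (simp add: lex_le_def)

lemma lex_less_empty: "A \<noteq> {} \<Longrightarrow> lex_less {} A"
  using lex_le_empty[of A] unfolding lex_le_iff by blast

lemma lex_less_insert_above:
  assumes "\<forall>a\<in>A. a < l"
  shows "lex_less A (insert l A)"
  unfolding lex_less_def using assms by (intro bexI[of _ l]) auto

text \<open>The deciding element lies in \<open>B\<close>, hence below \<open>l\<close>, so adding
  \<open>l\<close> to \<open>A\<close> comes too late to change the comparison.\<close>

lemma lex_less_insert_left:
  assumes "lex_less A B" "\<forall>b\<in>B. b < l"
  shows "lex_less (insert l A) B"
proof -
  obtain m where m: "m \<in> B - A" "\<forall>k<m. k \<in> A \<longleftrightarrow> k \<in> B" using assms(1) unfolding lex_less_def by blast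
  then have "m < l" using assms(2) by blast
  then show ?thesis unfolding lex_less_def using m by (intro bexI[of _ m]) auto
qed

text \<open>Totality gives a greatest element and antisymmetry its uniqueness, so the
  \<open>THE\<close> in \<open>lex_max\<close> denotes.\<close>

lemma lex_max:
  assumes "finite S" "S \<noteq> {}"
  shows "lex_max S \<in> S" "A \<in> S \<Longrightarrow> lex_le A (lex_max S)"
proof -
  have "\<exists>M\<in>S. \<forall>B\<in>S. lex_le B M"
    using assms
  proof (induction S rule: finite_ne_induct)
    case (singleton A)
    then show ?case by (simp add: lex_le_refl)
  next
    case (insert A S)
    then obtain M where "M \<in> S" "\<forall>B\<in>S. lex_le B M" by blast
    then show ?case using lex_le_linear[of A M] lex_le_refl[of A] lex_le_trans by blast
  qed
  then have "\<exists>!M. M \<in> S \<and> (\<forall>B\<in>S. lex_le B M)" using lex_le_antisym by blast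
  then have "lex_max S \<in> S \<and> (\<forall>B\<in>S. lex_le B (lex_max S))" unfolding lex_max_def by (rule theI')
  then show "lex_max S \<in> S" "A \<in> S \<Longrightarrow> lex_le A (lex_max S)" by blast+
qed

section \<open>Chains of indecomposables and jointly monic families\<close>

context abelian_length_category
begin

lemma ind_chain_singleton: "indecomposable C X \<Longrightarrow> ind_chain C X [X]"
  by (simp add: ind_chain_def)

lemma ind_chain_snoc:
  "ind_chain C X Zs \<Longrightarrow> strict_sub C X Y \<Longrightarrow> indecomposable C Y \<Longrightarrow> ind_chain C Y (Zs @ [Y])"
  by (auto simp: ind_chain_def successively_append_iff)

lemma ind_chain_cases:
  assumes "ind_chain C X Xs"
  obtains "Xs = [X]" | X' Zs where "Xs = Zs @ [X]" "ind_chain C X' Zs" "strict_sub C X' X" "indecomposable C X'"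
proof -
  have Xs: "Xs = butlast Xs @ [X]" using assms unfolding ind_chain_def by (metis append_butlast_last_id)
  show thesis
  proof (cases "butlast Xs = []")
    case True
    then show thesis using that(1) Xs by simp
  next
    case False
    have "successively (strict_sub C) (butlast Xs @ [X])" "\<forall>Y\<in>set (butlast Xs @ [X]). indecomposable C Y"
      using assms Xs unfolding ind_chain_def by metis+
    then have "ind_chain C (last (butlast Xs)) (butlast Xs)" "strict_sub C (last (butlast Xs)) X"
      "indecomposable C (last (butlast Xs))"
      using False unfolding ind_chain_def successively_append_iff by auto
    then show thesis using that(2) Xs by blast
  qed
qed

lemma ind_chain_comp_length:
  assumes "ind_chain C X Xs" "Y \<in> set Xs"
  shows "comp_length C Y \<le> comp_length C X"
  using assms
proof (induction Xs arbitrary: X rule: rev_induct)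
  case Nil
  then show ?case by simp
next
  case (snoc Z Zs)
  from snoc.prems(1) show ?case
  proof (cases rule: ind_chain_cases)
    case 1
    then show ?thesis using snoc.prems(2) by auto
  next
    case (2 X' Zs')
    then show ?thesis
      using snoc.IH[of X'] snoc.prems(2) comp_length_strict_sub[OF 2(3)] by fastforce
  qed
qed

text \<open>All lengths along a chain are bounded by that of \<open>X\<close>, so only finitely many
  length sets occur although there may be infinitely many chains; the chain \<open>[X]\<close> shows
  that some occurs.\<close>

lemma ell_star_ind_max:
  assumes "indecomposable C X"
  shows "\<exists>Xs. ind_chain C X Xs \<and> ell_star_ind C X = comp_length C ` set Xs"
    and "ind_chain C X Ys \<Longrightarrow> lex_le (comp_length C ` set Ys) (ell_star_ind C X)"
proof -
  let ?S = "{comp_length C ` set Xs |Xs. ind_chain C X Xs}"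
  have "?S \<subseteq> Pow {..comp_length C X}" using ind_chain_comp_length by blast
  then have fin: "finite ?S" by (rule finite_subset) simp
  have ne: "?S \<noteq> {}" using ind_chain_singleton[OF assms] by blast
  show "\<exists>Xs. ind_chain C X Xs \<and> ell_star_ind C X = comp_length C ` set Xs"
    using lex_max(1)[OF fin ne] unfolding ell_star_ind_def by blast
  show "lex_le (comp_length C ` set Ys) (ell_star_ind C X)" if "ind_chain C X Ys"
    using lex_max(2)[OF fin ne] that unfolding ell_star_ind_def by blast
qed

lemma ell_star_ind_le: "indecomposable C X \<Longrightarrow> n \<in> ell_star_ind C X \<Longrightarrow> n \<le> comp_length C X"
  using ell_star_ind_max(1)[of X] ind_chain_comp_length by fastforce

lemma ell_star_ind_nonempty: "indecomposable C X \<Longrightarrow> ell_star_ind C X \<noteq> {}"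
  using ell_star_ind_max(1)[of X] by (auto simp: ind_chain_def)

text \<open>Appending \<open>Y\<close> to an optimal chain for \<open>X\<close> adds a length above
  all the others, which raises the set.\<close>

lemma ell_star_ind_strict_sub:
  assumes X: "indecomposable C X" and Y: "indecomposable C Y" and XY: "strict_sub C X Y"
  shows "lex_less (ell_star_ind C X) (ell_star_ind C Y)"
proof -
  obtain Zs where Zs: "ind_chain C X Zs" "ell_star_ind C X = comp_length C ` set Zs"
    using ell_star_ind_max(1)[OF X] by blast
  have "\<forall>n\<in>ell_star_ind C X. n < comp_length C Y"
    using ell_star_ind_le[OF X] comp_length_strict_sub[OF XY] le_less_trans by blast
  then have "lex_less (ell_star_ind C X) (insert (comp_length C Y) (ell_star_ind C X))"
    by (rule lex_less_insert_above)
  moreover have "lex_le (insert (comp_length C Y) (ell_star_ind C X)) (ell_star_ind C Y)"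
    using ell_star_ind_max(2)[OF Y ind_chain_snoc[OF Zs(1) XY Y]] Zs(2) by simp
  ultimately show ?thesis using lex_less_le_trans by blast
qed

text \<open>Replacing the last object of an optimal chain for \<open>X\<close> by \<open>Y\<close>
  yields a chain with the same lengths.\<close>

lemma ell_star_ind_isomorphic:
  assumes X: "indecomposable C X" and Y: "indecomposable C Y" and XY: "isomorphic C X Y"
  shows "lex_le (ell_star_ind C X) (ell_star_ind C Y)"
proof -
  have l: "comp_length C X = comp_length C Y" using comp_length_isomorphic[OF XY] .
  obtain Xs where Xs: "ind_chain C X Xs" "ell_star_ind C X = comp_length C ` set Xs"
    using ell_star_ind_max(1)[OF X] by blast
  from Xs(1) show ?thesis
  proof (cases rule: ind_chain_cases)
    case 1
    then show ?thesis using ell_star_ind_max(2)[OF Y ind_chain_singleton[OF Y]] Xs(2) l by simp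
  next
    case (2 X' Zs)
    have "sub C X' Y" using 2(3) sub_trans isomorphic_sub[OF XY] unfolding strict_sub_def by blast
    moreover have "\<not> isomorphic C X' Y"
      using 2(3) isomorphic_trans[OF _ isomorphic_sym[OF XY]] unfolding strict_sub_def by blast
    ultimately have "ind_chain C Y (Zs @ [Y])"
      using ind_chain_snoc[OF 2(2) _ Y] unfolding strict_sub_def by blast
    then show ?thesis using ell_star_ind_max(2)[OF Y] Xs(2) 2(1) l by fastforce
  qed
qed

lemma ell_star_ind_sub:
  assumes X: "indecomposable C X" and Y: "indecomposable C Y" and XY: "sub C X Y"
  shows "lex_le (ell_star_ind C X) (ell_star_ind C Y)"
  using ell_star_ind_isomorphic[OF X Y] ell_star_ind_strict_sub[OF X Y] XY
  unfolding strict_sub_def lex_le_iff by blast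

text \<open>An optimal chain for \<open>X\<close> is a chain for a proper subobject followed by
  \<open>X\<close>. The bound for the subobject persists because the length of \<open>X\<close>
  exceeds everything in the sets compared with.\<close>

lemma ell_star_ind_less_of_subobjects:
  assumes X: "indecomposable C X" and ne: "\<Y> \<noteq> {}"
    and Y: "\<And>Y. Y \<in> \<Y> \<Longrightarrow> indecomposable C Y" "\<And>Y. Y \<in> \<Y> \<Longrightarrow> comp_length C Y < comp_length C X"
    and sub: "\<And>X'. indecomposable C X' \<Longrightarrow> strict_sub C X' X \<Longrightarrow>
      \<exists>Y\<in>\<Y>. lex_less (ell_star_ind C X') (ell_star_ind C Y)"
  shows "\<exists>Y\<in>\<Y>. lex_less (ell_star_ind C X) (ell_star_ind C Y)"
proof -
  have below: "\<forall>n\<in>ell_star_ind C Y. n < comp_length C X" if "Y \<in> \<Y>" for Y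
    using ell_star_ind_le[OF Y(1)[OF that]] Y(2)[OF that] le_less_trans by blast
  obtain Xs where Xs: "ind_chain C X Xs" "ell_star_ind C X = comp_length C ` set Xs"
    using ell_star_ind_max(1)[OF X] by blast
  from Xs(1) show ?thesis
  proof (cases rule: ind_chain_cases)
    case 1
    obtain Y where Y': "Y \<in> \<Y>" using ne by blast
    \<comment> \<open>The optimal chain is \<open>[X]\<close>: any \<open>Y\<close> serves, since
      its set is nonempty and lies below the length of \<open>X\<close>.\<close>
    have "lex_less (insert (comp_length C X) {}) (ell_star_ind C Y)"
      using lex_less_insert_left[OF lex_less_empty[OF ell_star_ind_nonempty] below] Y(1) Y' by blast
    then show ?thesis using Y' Xs(2) 1 by auto
  next
    case (2 X' Zs)
    obtain Y where Y': "Y \<in> \<Y>" "lex_less (ell_star_ind C X') (ell_star_ind C Y)" using sub[OF 2(4,3)] by blast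
    have "lex_less (comp_length C ` set Zs) (ell_star_ind C Y)"
      using lex_le_less_trans[OF ell_star_ind_max(2)[OF 2(4,2)] Y'(2)] .
    then have "lex_less (insert (comp_length C X) (comp_length C ` set Zs)) (ell_star_ind C Y)"
      using lex_less_insert_left below[OF Y'(1)] by blast
    then show ?thesis using Y' Xs(2) 2(1) by auto
  qed
qed

definition jointly_monic :: "'a \<Rightarrow> 'b set \<Rightarrow> bool" where
  "jointly_monic X F \<longleftrightarrow>
    (\<forall>W. \<forall>g\<in>Hom C W X. \<forall>h\<in>Hom C W X. (\<forall>f\<in>F. f \<cdot> g = f \<cdot> h) \<longrightarrow> g = h)"

lemma jointly_monicD:
  "jointly_monic X F \<Longrightarrow> g \<in> Hom C W X \<Longrightarrow> h \<in> Hom C W X \<Longrightarrow> (\<And>f. f \<in> F \<Longrightarrow> f \<cdot> g = f \<cdot> h) \<Longrightarrow> g = h"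
  unfolding jointly_monic_def by blast

lemma ell_star_ind_jointly_monic:
  assumes "indecomposable C X" "jointly_monic X F"
    and "\<And>f. f \<in> F \<Longrightarrow> f \<in> Hom C X (tgt C f)" "\<And>f. f \<in> F \<Longrightarrow> indecomposable C (tgt C f)"
  shows "\<exists>f\<in>F. is_iso C f \<or> lex_less (ell_star_ind C X) (ell_star_ind C (tgt C f))"
  using assms
\<comment> \<open>\<open>F\<close> is generalized because the hypothesis will be applied to
  \<open>X'\<close> with composites in place of \<open>F\<close>.\<close>
proof (induction "comp_length C X" arbitrary: X F rule: less_induct)
  case less
  note X = less.prems(1) and jm = less.prems(2) and FH = less.prems(3) and Find = less.prems(4)
  have Xo: "X \<in> obj C" and Xnz: "\<not> is_zero_obj C X" using X unfolding indecomposable_def by blast+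
  show ?case
  proof (cases "\<exists>f\<in>F. is_mono C f")
    case True
    \<comment> \<open>A monic member is an isomorphism, or it embeds \<open>X\<close> properly into
      its target.\<close>
    then obtain f where f: "f \<in> F" "is_mono C f" by blast
    then show ?thesis
      using ell_star_ind_strict_sub[OF X Find[OF f(1)]] mono_strict_sub[OF FH[OF f(1)] f(2)] by blast
  next
    case False
    \<comment> \<open>\<open>G\<close> gathers the components of all images at once. The condition
      on \<open>sub\<close> serves to return from the targets of \<open>G\<close> to those of
      \<open>F\<close> at the end.\<close>
    define G where "G = {g. g \<in> Hom C X (tgt C g) \<and> is_epi C g \<and> \<not> is_mono C g \<and>
      indecomposable C (tgt C g) \<and> (\<exists>f\<in>F. sub C (tgt C g) (tgt C f))}"
    \<comment> \<open>Arrows not separated by \<open>G\<close> agree after each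
      \<open>pr i \<cdot> e\<close>, hence after \<open>e\<close>, hence after each
      \<open>f = m \<cdot> e\<close>.\<close>
    have Gjm: "jointly_monic X G"
      unfolding jointly_monic_def
    proof (intro allI ballI impI)
      fix W a b assume a: "a \<in> Hom C W X" and b: "b \<in> Hom C W X" and eq: "\<forall>g\<in>G. g \<cdot> a = g \<cdot> b"
      show "a = b"
      proof (rule jointly_monicD[OF jm a b])
        fix f assume f: "f \<in> F"
        obtain I e m where em: "e \<in> Hom C X I" "m \<in> Hom C I (tgt C f)" "is_epi C e" "is_mono C m" "m \<cdot> e = f"
          using epi_mono_factorization[OF FH[OF f]] .
        obtain Ys inc pr where Ys: "is_direct_sum C I Ys inc pr" "\<forall>Y\<in>set Ys. indecomposable C Y"
          using indecomposable_decomposition[OF HomD(5)[OF em(1)]] .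
        have ea: "e \<cdot> a \<in> Hom C W I" and eb: "e \<cdot> b \<in> Hom C W I"
          using comp_Hom[OF a em(1)] comp_Hom[OF b em(1)] .
        have "e \<cdot> a = e \<cdot> b"
        proof (rule direct_sum_jointly_monic[OF Ys(1) ea eb])
          fix i assume i: "i < length Ys"
          note p = direct_sumD(4)[OF Ys(1) i]
          have pe: "pr i \<cdot> e \<in> Hom C X (Ys ! i)" using comp_Hom[OF em(1) p] .
          have "is_epi C (pr i \<cdot> e)" using epi_comp[OF em(1) p em(3) direct_sum_pr_epi[OF Ys(1) i]] .
          \<comment> \<open>Otherwise \<open>e\<close> would be mono and with it
            \<open>f = m \<cdot> e\<close>, which this case excludes.\<close>
          moreover have "\<not> is_mono C (pr i \<cdot> e)"
            using mono_cancel[OF em(1) p] mono_comp[OF em(1,2) _ em(4)] em(5) False f by metis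
          moreover have "sub C (Ys ! i) (tgt C f)"
            using sub_trans[of "Ys ! i" I] direct_sumD(3)[OF Ys(1) i] direct_sum_inc_mono[OF Ys(1) i] em(2,4)
            unfolding sub_def by blast
          ultimately have "pr i \<cdot> e \<in> G"
            using pe HomD(3)[OF pe] Ys(2) i f unfolding G_def by auto
          then have "(pr i \<cdot> e) \<cdot> a = (pr i \<cdot> e) \<cdot> b" using eq by blast
          then show "pr i \<cdot> (e \<cdot> a) = pr i \<cdot> (e \<cdot> b)"
            using comp_assoc[OF a em(1) p] comp_assoc[OF b em(1) p] by simp
        qed
        then show "f \<cdot> a = f \<cdot> b"
          using comp_assoc[OF a em(1,2)] comp_assoc[OF b em(1,2)] em(5) by simp
      qed
    qed
    \<comment> \<open>An empty jointly monic family would identify the identity of \<open>X\<close>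
      with zero.\<close>
    have "G \<noteq> {}"
    proof
      assume "G = {}"
      then have "ident C X = zero_arr C X X"
        using jointly_monicD[OF Gjm ident_Hom[OF Xo] zero_Hom[OF Xo Xo]] by blast
      then show False using Xnz zero_obj_iff[OF Xo] by blast
    qed
    have G: "g \<in> Hom C X (tgt C g)" "indecomposable C (tgt C g)" "comp_length C (tgt C g) < comp_length C X"
      if "g \<in> G" for g
      using that comp_length_epi[of g X "tgt C g"] iso_mono[of g] unfolding G_def by blast+
    have "\<exists>Y\<in>tgt C ` G. lex_less (ell_star_ind C X) (ell_star_ind C Y)"
    proof (rule ell_star_ind_less_of_subobjects[OF X])
      fix X' assume X': "indecomposable C X'" "strict_sub C X' X"
      then obtain h where h: "h \<in> Hom C X' X" "is_mono C h" "\<not> is_iso C h"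
        unfolding strict_sub_def sub_def isomorphic_def by blast
      have X'nz: "\<not> is_zero_obj C X'" using X'(1) unfolding indecomposable_def by blast
      have gh: "g \<cdot> h \<in> Hom C X' (tgt C g)" if "g \<in> G" for g using comp_Hom[OF h(1) G(1)[OF that]] .
      \<comment> \<open>Restricting a jointly monic family along the monomorphism \<open>h\<close>
        keeps it jointly monic, and \<open>X'\<close> is shorter than \<open>X\<close>.\<close>
      have "\<exists>f\<in>(\<lambda>g. g \<cdot> h) ` G. is_iso C f \<or> lex_less (ell_star_ind C X') (ell_star_ind C (tgt C f))"
      proof (rule less.hyps[OF comp_length_strict_sub[OF X'(2)] X'(1)])
        show "jointly_monic X' ((\<lambda>g. g \<cdot> h) ` G)"
          unfolding jointly_monic_def
        proof (intro allI ballI impI)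
          fix W a b assume a: "a \<in> Hom C W X'" and b: "b \<in> Hom C W X'"
            and eq: "\<forall>f\<in>(\<lambda>g. g \<cdot> h) ` G. f \<cdot> a = f \<cdot> b"
          have "h \<cdot> a = h \<cdot> b"
          proof (rule jointly_monicD[OF Gjm comp_Hom[OF a h(1)] comp_Hom[OF b h(1)]])
            fix g assume g: "g \<in> G"
            show "g \<cdot> (h \<cdot> a) = g \<cdot> (h \<cdot> b)"
              using comp_assoc[OF a h(1) G(1)[OF g]] comp_assoc[OF b h(1) G(1)[OF g]] eq g by simp
          qed
          then show "a = b" using h(2) a b unfolding mono_iff[OF h(1)] by blast
        qed
        show "f \<in> Hom C X' (tgt C f)" "indecomposable C (tgt C f)" if "f \<in> (\<lambda>g. g \<cdot> h) ` G" for f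
          using that gh HomD(3)[OF gh] G(2) by auto
      qed
      then obtain g where g: "g \<in> G"
        "is_iso C (g \<cdot> h) \<or> lex_less (ell_star_ind C X') (ell_star_ind C (tgt C g))"
        using HomD(3)[OF gh] by auto
      \<comment> \<open>An inverse \<open>s\<close> would make \<open>s \<cdot> g\<close> a
        retraction of \<open>h\<close>, and \<open>X'\<close> would be a nonzero summand of the
        indecomposable \<open>X\<close>, so \<open>h\<close> would be an isomorphism.\<close>
      have "\<not> is_iso C (g \<cdot> h)"
      proof
        assume "is_iso C (g \<cdot> h)"
        then obtain s where s: "s \<in> Hom C (tgt C g) X'" "s \<cdot> (g \<cdot> h) = ident C X'"
          using isoE[OF gh[OF g(1)]] by metis
        have "(s \<cdot> g) \<cdot> h = ident C X'" using comp_assoc[OF h(1) G(1)[OF g(1)] s(1)] s(2) by simp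
        then show False
          using indecomposable_retract[OF X'nz X h(1) comp_Hom[OF G(1)[OF g(1)] s(1)]] h(3) by blast
      qed
      then show "\<exists>Y\<in>tgt C ` G. lex_less (ell_star_ind C X') (ell_star_ind C Y)" using g by blast
    qed (use G \<open>G \<noteq> {}\<close> in auto)
    then obtain g where g: "g \<in> G" "lex_less (ell_star_ind C X) (ell_star_ind C (tgt C g))" by blast
    then obtain f where f: "f \<in> F" "sub C (tgt C g) (tgt C f)" unfolding G_def by blast
    have "lex_less (ell_star_ind C X) (ell_star_ind C (tgt C f))"
      using lex_less_le_trans[OF g(2) ell_star_ind_sub[OF G(2)[OF g(1)] Find[OF f(1)] f(2)]] .
    then show ?thesis using f(1) by blast
  qed
qed

text \<open>A summand \<open>Z\<close> of \<open>X\<close> attains the maximum. The components of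
  \<open>Z \<rightarrow> X \<rightarrow> Y\<close> in the summands of \<open>Y\<close> are jointly
  monic, so \<open>ell_star_ind_jointly_monic\<close> finds a summand of \<open>Y\<close> at least
  as large.\<close>

lemma decomposition_mono:
  assumes X: "is_direct_sum C X Xs incX prX" "\<forall>Z\<in>set Xs. indecomposable C Z"
    and Y: "is_direct_sum C Y Ys incY prY" "\<forall>Z\<in>set Ys. indecomposable C Z"
    and f: "f \<in> Hom C X Y" "is_mono C f"
  shows "lex_le (if Xs = [] then {} else lex_max (ell_star_ind C ` set Xs))
    (if Ys = [] then {} else lex_max (ell_star_ind C ` set Ys))"
proof (cases "Xs = []")
  case True
  then show ?thesis by (simp add: lex_le_empty)
next
  case False
  then have "lex_max (ell_star_ind C ` set Xs) \<in> ell_star_ind C ` set Xs" by (intro lex_max(1)) auto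
  then obtain i where i: "i < length Xs" "lex_max (ell_star_ind C ` set Xs) = ell_star_ind C (Xs ! i)"
    by (auto simp: in_set_conv_nth)
  define Z where "Z = Xs ! i"
  have Z: "indecomposable C Z" using X(2) i(1) unfolding Z_def by simp
  define g where "g = f \<cdot> incX i"
  have inc: "incX i \<in> Hom C Z X" using direct_sumD(3)[OF X(1) i(1)] unfolding Z_def .
  have g: "g \<in> Hom C Z Y" "is_mono C g"
    using comp_Hom[OF inc f(1)] mono_comp[OF inc f(1) direct_sum_inc_mono[OF X(1) i(1)] f(2)]
    unfolding g_def by blast+
  have pg: "prY j \<cdot> g \<in> Hom C Z (Ys ! j)" if "j < length Ys" for j
    using comp_Hom[OF g(1) direct_sumD(4)[OF Y(1) that]] .
  let ?F = "(\<lambda>j. prY j \<cdot> g) ` {..<length Ys}"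
  have "jointly_monic Z ?F"
    unfolding jointly_monic_def
  proof (intro allI ballI impI)
    fix W a b assume a: "a \<in> Hom C W Z" and b: "b \<in> Hom C W Z" and eq: "\<forall>f\<in>?F. f \<cdot> a = f \<cdot> b"
    have "g \<cdot> a = g \<cdot> b"
    proof (rule direct_sum_jointly_monic[OF Y(1) comp_Hom[OF a g(1)] comp_Hom[OF b g(1)]])
      fix j assume j: "j < length Ys"
      note p = direct_sumD(4)[OF Y(1) j]
      show "prY j \<cdot> (g \<cdot> a) = prY j \<cdot> (g \<cdot> b)"
        using comp_assoc[OF a g(1) p] comp_assoc[OF b g(1) p] eq j by simp
    qed
    then show "a = b" using g(2) a b unfolding mono_iff[OF g(1)] by blast
  qed
  then have "\<exists>f\<in>?F. is_iso C f \<or> lex_less (ell_star_ind C Z) (ell_star_ind C (tgt C f))"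
    using pg HomD(3)[OF pg] Y(2) by (intro ell_star_ind_jointly_monic[OF Z]) auto
  then obtain j where j: "j < length Ys"
    "is_iso C (prY j \<cdot> g) \<or> lex_less (ell_star_ind C Z) (ell_star_ind C (Ys ! j))"
    using HomD(3)[OF pg] by auto
  have Yj: "indecomposable C (Ys ! j)" using Y(2) j(1) by simp
  have "lex_le (ell_star_ind C Z) (ell_star_ind C (Ys ! j))"
    using j(2)
  proof
    assume "is_iso C (prY j \<cdot> g)"
    then have "isomorphic C Z (Ys ! j)" using pg[OF j(1)] unfolding isomorphic_def by blast
    then show ?thesis using ell_star_ind_isomorphic[OF Z Yj] by blast
  qed (simp add: lex_le_iff)
  moreover have "lex_le (ell_star_ind C (Ys ! j)) (lex_max (ell_star_ind C ` set Ys))"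
    using j(1) by (intro lex_max(2)) auto
  ultimately have "lex_le (ell_star_ind C Z) (lex_max (ell_star_ind C ` set Ys))"
    using lex_le_trans by blast
  \<comment> \<open>The index \<open>j\<close> rules out the default value \<open>{}\<close> on the
    right.\<close>
  moreover have "Ys \<noteq> []" using j(1) by auto
  ultimately show ?thesis using False i(2) unfolding Z_def by simp
qed

text \<open>The identity of \<open>X\<close> compares any two decompositions in both directions, so
  antisymmetry makes the \<open>THE\<close> denote.\<close>

lemma ell_star_decomposition:
  assumes "is_direct_sum C X Xs inc pr" "\<forall>Y\<in>set Xs. indecomposable C Y"
  shows "ell_star C X = (if Xs = [] then {} else lex_max (ell_star_ind C ` set Xs))"
  unfolding ell_star_def
proof (rule the_equality)
  show "\<exists>Ys inc pr. is_direct_sum C X Ys inc pr \<and> (\<forall>Y\<in>set Ys. indecomposable C Y) \<and>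
      (if Xs = [] then {} else lex_max (ell_star_ind C ` set Xs)) =
      (if Ys = [] then {} else lex_max (ell_star_ind C ` set Ys))"
    using assms by blast
next
  fix A assume "\<exists>Ys inc pr. is_direct_sum C X Ys inc pr \<and> (\<forall>Y\<in>set Ys. indecomposable C Y) \<and>
      A = (if Ys = [] then {} else lex_max (ell_star_ind C ` set Ys))"
  then obtain Ys inc' pr' where Ys: "is_direct_sum C X Ys inc' pr'" "\<forall>Y\<in>set Ys. indecomposable C Y"
    and A: "A = (if Ys = [] then {} else lex_max (ell_star_ind C ` set Ys))" by blast
  have X: "X \<in> obj C" using direct_sumD(1)[OF assms(1)] .
  note id = ident_Hom[OF X] iso_mono[OF ident_iso[OF X]]
  show "A = (if Xs = [] then {} else lex_max (ell_star_ind C ` set Xs))"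
    unfolding A using lex_le_antisym[OF decomposition_mono[OF Ys assms id] decomposition_mono[OF assms Ys id]] .
qed

text \<open>Choosing decompositions of both objects turns \<open>decomposition_mono\<close> into
  (M3) at the level of objects.\<close>

lemma ell_star_sub:
  assumes "sub C X Y"
  shows "lex_le (ell_star C X) (ell_star C Y)"
proof -
  obtain f where f: "f \<in> Hom C X Y" "is_mono C f" using assms unfolding sub_def by blast
  obtain Xs incX prX where X: "is_direct_sum C X Xs incX prX" "\<forall>Z\<in>set Xs. indecomposable C Z"
    using indecomposable_decomposition[OF HomD(4)[OF f(1)]] .
  obtain Ys incY prY where Y: "is_direct_sum C Y Ys incY prY" "\<forall>Z\<in>set Ys. indecomposable C Z"
    using indecomposable_decomposition[OF HomD(5)[OF f(1)]] .
  show ?thesis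
    using decomposition_mono[OF X Y f] ell_star_decomposition[OF X] ell_star_decomposition[OF Y] by simp
qed

lemma ell_star_isomorphic: "isomorphic C X Y \<Longrightarrow> ell_star C X = ell_star C Y"
  by (intro lex_le_antisym ell_star_sub isomorphic_sub) (auto intro: isomorphic_sym)

section \<open>Passage to isomorphism classes\<close>

lemma iso_classesD:
  assumes "a \<in> iso_classes C"
  shows "\<exists>X. X \<in> a" "X \<in> a \<Longrightarrow> X \<in> obj C" "X \<in> a \<Longrightarrow> Y \<in> a \<Longrightarrow> isomorphic C X Y"
proof -
  obtain Z where Z: "Z \<in> obj C" "a = iso_rel C `` {Z}" using assms unfolding iso_classes_def by (rule quotientE)
  show "\<exists>X. X \<in> a" using Z equiv_class_self[OF equiv_iso_rel] by blast
  show "X \<in> obj C" if "X \<in> a" using that Z unfolding iso_rel_def by blast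
  show "isomorphic C X Y" if "X \<in> a" "Y \<in> a"
    using that Z isomorphic_trans[OF isomorphic_sym] unfolding iso_rel_def by blast
qed

lemma iso_classes_eqI:
  assumes "a \<in> iso_classes C" "b \<in> iso_classes C" "X \<in> a" "Y \<in> b" "isomorphic C X Y"
  shows "a = b"
  using quotient_eqI[OF equiv_iso_rel] assms iso_classesD(2) unfolding iso_classes_def iso_rel_def by blast

text \<open>All representatives of a class are isomorphic, so for an invariant \<open>P\<close> the
  existential in \<open>induced_rel\<close> may be tested on any chosen pair.\<close>

lemma induced_rel_iff:
  assumes P: "\<And>X X' Y Y'. isomorphic C X' X \<Longrightarrow> isomorphic C Y Y' \<Longrightarrow> P X Y \<Longrightarrow> P X' Y'"
    and "a \<in> iso_classes C" "b \<in> iso_classes C" "X \<in> a" "Y \<in> b"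
  shows "(a, b) \<in> induced_rel C P \<longleftrightarrow> P X Y"
  unfolding induced_rel_def using assms iso_classesD(3) by blast

lemma induced_rel_sub_iff:
  "a \<in> iso_classes C \<Longrightarrow> b \<in> iso_classes C \<Longrightarrow> X \<in> a \<Longrightarrow> Y \<in> b \<Longrightarrow>
    (a, b) \<in> induced_rel C (sub C) \<longleftrightarrow> sub C X Y"
  by (rule induced_rel_iff) (blast intro: sub_trans isomorphic_sub)+

lemma induced_rel_mu_le_iff:
  "a \<in> iso_classes C \<Longrightarrow> b \<in> iso_classes C \<Longrightarrow> X \<in> a \<Longrightarrow> Y \<in> b \<Longrightarrow>
    (a, b) \<in> induced_rel C (mu_le C) \<longleftrightarrow> mu_le C X Y"
  by (rule induced_rel_iff) (simp_all add: mu_le_def ell_star_isomorphic)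

text \<open>This is the well-definedness hidden in the word "induces": isomorphic objects have equal
  \<open>ell_star\<close>.\<close>

lemma mu_le_respects2: "mu_le C respects2 iso_rel C"
  unfolding congruent2_def mu_le_def using ell_star_isomorphic by (auto simp: iso_rel_def)

lemma partial_order_sub: "partial_order_on (iso_classes C) (induced_rel C (sub C))"
proof -
  note iff = induced_rel_sub_iff
  have in_classes: "a \<in> iso_classes C" "b \<in> iso_classes C" if "(a, b) \<in> induced_rel C P" for a b P
    using that unfolding induced_rel_def by auto
  have "refl_on (iso_classes C) (induced_rel C (sub C))"
    using iso_classesD(1) iff isomorphic_sub[OF iso_classesD(3)] by (intro refl_onI) blast
  moreover have "trans (induced_rel C (sub C))"
  proof (rule transI)
    fix a b c assume ab: "(a, b) \<in> induced_rel C (sub C)" and bc: "(b, c) \<in> induced_rel C (sub C)"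
    note cl = in_classes[OF ab] in_classes[OF bc]
    obtain X Y Z where "X \<in> a" "Y \<in> b" "Z \<in> c" using iso_classesD(1) cl by meson
    then show "(a, c) \<in> induced_rel C (sub C)"
      using ab bc cl iff[of a b X Y] iff[of b c Y Z] iff[of a c X Z] sub_trans by blast
  qed
  moreover have "antisym (induced_rel C (sub C))"
  proof (rule antisymI)
    fix a b assume ab: "(a, b) \<in> induced_rel C (sub C)" and ba: "(b, a) \<in> induced_rel C (sub C)"
    note cl = in_classes[OF ab]
    obtain X Y where XY: "X \<in> a" "Y \<in> b" using iso_classesD(1) cl by meson
    then show "a = b"
      using ab ba cl iff[of a b X Y] iff[of b a Y X] sub_antisym iso_classes_eqI[OF cl XY] by blast
  qed
  moreover have "induced_rel C (sub C) \<subseteq> iso_classes C \<times> iso_classes C"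
    unfolding induced_rel_def by auto
  ultimately show ?thesis unfolding partial_order_on_def preorder_on_def by blast
qed

text \<open>On representatives, (M1) and (M2) are transitivity and totality of
  \<open>lex_le\<close>, and (M3) is \<open>ell_star_sub\<close>.\<close>

lemma poset_measure_mu_le:
  "poset_measure (iso_classes C) (induced_rel C (sub C)) (induced_rel C (mu_le C))"
proof -
  note iff = induced_rel_mu_le_iff and sub_iff = induced_rel_sub_iff
  have "(a, c) \<in> induced_rel C (mu_le C)"
    if cl: "a \<in> iso_classes C" "b \<in> iso_classes C" "c \<in> iso_classes C"
      and ab: "(a, b) \<in> induced_rel C (mu_le C)" and bc: "(b, c) \<in> induced_rel C (mu_le C)" for a b c
  proof -
    obtain X Y Z where "X \<in> a" "Y \<in> b" "Z \<in> c" using iso_classesD(1) cl by meson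
    then show ?thesis
      using ab bc cl iff[of a b X Y] iff[of b c Y Z] iff[of a c X Z] lex_le_trans unfolding mu_le_def by blast
  qed
  moreover have "((a, b) \<in> induced_rel C (mu_le C) \<or> (b, a) \<in> induced_rel C (mu_le C)) \<and>
      ((a, b) \<in> induced_rel C (sub C) \<longrightarrow> (a, b) \<in> induced_rel C (mu_le C))"
    if cl: "a \<in> iso_classes C" "b \<in> iso_classes C" for a b
  proof -
    obtain X Y where "X \<in> a" "Y \<in> b" using iso_classesD(1) cl by meson
    then show ?thesis
      using cl iff[of a b X Y] iff[of b a Y X] sub_iff[of a b X Y] lex_le_linear ell_star_sub
      unfolding mu_le_def by blast
  qed
  moreover have "induced_rel C (mu_le C) \<subseteq> iso_classes C \<times> iso_classes C"
    unfolding induced_rel_def by auto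
  ultimately show ?thesis
    unfolding poset_measure_def using partial_order_sub by blast
qed

end

theorem mainTheorem4:
  fixes C :: "('o, 'm) precat"
  assumes "abelian_length_category C"
  shows "mu_le C respects2 iso_rel C \<and>
         poset_measure (iso_classes C) (induced_rel C (sub C)) (induced_rel C (mu_le C))"
  using abelian_length_category.mu_le_respects2[OF assms]
    abelian_length_category.poset_measure_mu_le[OF assms] by blast

end
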